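(* Let $A\in\mathbb R^{n\times n}$, $B\in\mathbb R^{n\times m}$, $C\in\mathbb R^{p\times n}$, let $D\in\mathbb R^{q\times n}$ with $q\le n$ have full row rank, assume that $(A,B)$ is reachable and $(C,A)$ is observable, and let $N\ge n$. Let $\tau_N<\theta_N$ be the first value of $\theta$ for which the matrix $\Omega_N^\theta$ becomes singular. Then for every $\theta\in[0,\tau_N)$ the matrices $\Omega_N^\theta$ and $W_N^\theta$ are positive definite, and the $N$-block risk-sensitive Riccati map $$r_d^\theta(P)=\alpha_N^\theta\,[P^{-1}+\Omega_N^\theta]^{-1}(\alpha_N^\theta)^T+W_N^\theta,\qquad P\in\mathcal P,$$ is strictly contractive on $\mathcal P$ for the Riemann distance $d$ and has a unique fixed point in $\mathcal P$. Moreover $r_d^\theta=(r^\theta)^N$ is the $N$-fold composition (wherever this composition is defined) of the risk-sensitive Riccati map $$r^\theta(P)=A[P^{-1}+C^TC-\theta D^TD]^{-1}A^T+BB^T.$$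
   Context: All matrices are real. $\mathcal P$ is the cone of $n\times n$ symmetric positive definite matrices; $\lambda_1(\cdot)$ is the largest eigenvalue. The Riemann distance on $\mathcal P$ is $d(P,Q)=\|\log(P^{-1/2}QP^{-1/2})\|_F=\big(\sum_{i=1}^n(\log s_i)^2\big)^{1/2}$, where $s_1,\dots,s_n>0$ are the eigenvalues of $P^{-1}Q$. A map $f:\mathcal P\to\mathcal P$ is strictly contractive if there is $0\le c<1$ with $d(f(P),f(Q))\le c\,d(P,Q)$ for all $P,Q\in\mathcal P$. Block matrices. Put $$\mathcal R_N=\begin{bmatrix}B&AB&\cdots&A^{N-1}B\end{bmatrix},$$ $$\mathcal O_N=\begin{bmatrix}(CA^{N-1})^T&\cdots&(CA)^T&C^T\end{bmatrix}^T,\qquad \mathcal O_N^R=\begin{bmatrix}(DA^{N-1})^T&\cdots&(DA)^T&D^T\end{bmatrix}^T.$$ Let $H_t=CA^{t-1}B$ and $L_t=DA^{t-1}B$ for $t\ge1$, and $H_t=0$, $L_t=0$ for $t\le0$. $\mathcal H_N$ is the $Np\times Nm$ block Toeplitz matrix whose $(i,j)$ block is $H_{j-i}$, and $\mathcal L_N$ is the $Nq\times Nm$ block Toeplitz matrix whose $(i,j)$ block is $L_{j-i}$, $1\le i,j\le N$. Let $$\theta_N=1/\lambda_1\big(\mathcal L_N(I_{Nm}+\mathcal H_N^T\mathcal H_N)^{-1}\mathcal L_N^T\big)$$ (with $\theta_N=\infty$ if $\mathcal L_N=0$). For $0<\theta<\theta_N$ define $$\mathcal K_N^\theta=\begin{bmatrix}I_{Np}&0\\0&-\theta^{-1}I_{Nq}\end{bmatrix}+\begin{bmatrix}\mathcal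 H_N\\\mathcal L_N\end{bmatrix}\begin{bmatrix}\mathcal H_N^T&\mathcal L_N^T\end{bmatrix},\qquad \begin{bmatrix}\mathcal G_N^\theta&\mathcal G_N^{R\theta}\end{bmatrix}=\begin{bmatrix}\mathcal H_N^T&\mathcal L_N^T\end{bmatrix}(\mathcal K_N^\theta)^{-1},$$ $$\alpha_N^\theta=A^N-\mathcal R_N[\mathcal G_N^\theta\mathcal O_N+\mathcal G_N^{R\theta}\mathcal O_N^R],$$ $$\Omega_N^\theta=\begin{bmatrix}\mathcal O_N^T&(\mathcal O_N^R)^T\end{bmatrix}(\mathcal K_N^\theta)^{-1}\begin{bmatrix}\mathcal O_N\\\mathcal O_N^R\end{bmatrix},\qquad W_N^\theta=\mathcal R_N[I_{Nm}+\mathcal H_N^T\mathcal H_N-\theta\mathcal L_N^T\mathcal L_N]^{-1}\mathcal R_N^T.$$ For $\theta=0$, $(\mathcal K_N^\theta)^{-1}$ is replaced in these formulas by its limit as $\theta\to0^+$, namely the block diagonal matrix with diagonal blocks $(I_{Np}+\mathcal H_N\mathcal H_N^T)^{-1}$ and $0$; thus $\Omega_N^0=\mathcal O_N^T[I_{Np}+\mathcal H_N\mathcal H_N^T]^{-1}\mathcal O_N$ and $W_N^0=\mathcal R_N[I_{Nm}+\mathcal H_N^T\mathcal H_N]^{-1}\mathcal R_N^T$. *)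

theory Defs
  imports "HOL-Analysis.Analysis" "HOL-Computational_Algebra.Polynomial"
begin

section \<open>Matrices\<close>

definition mpow :: "real^'n^'n \<Rightarrow> nat \<Rightarrow> real^'n^'n" where
  "mpow A k = (((**) A) ^^ k) (mat 1)"

definition pos_def :: "real^'n^'n \<Rightarrow> bool" where
  "pos_def P \<longleftrightarrow> transpose P = P \<and> (\<forall>x. x \<noteq> 0 \<longrightarrow> x \<bullet> (P *v x) > 0)"

definition charpoly :: "real^'n^'n \<Rightarrow> real poly" where
  "charpoly M = det ((\<chi> i j. (if i = j then [:0, 1:] else 0) - [:M $ i $ j:]) :: (real poly)^'n^'n)"

text \<open>The real eigenvalues, each counted with its algebraic multiplicity. All eigenvalues
  are real in the two uses below: a symmetric matrix, and \<open>P\<inverse>Q\<close> with \<open>P\<close>, \<open>Q\<close> positive definite.\<close>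

definition eigvals :: "real^'n^'n \<Rightarrow> real multiset" where
  "eigvals M = proots (charpoly M)"

definition lambda1 :: "real^'n^'n \<Rightarrow> real" where
  "lambda1 M = Max (set_mset (eigvals M))"

definition riemann_dist :: "real^'n^'n \<Rightarrow> real^'n^'n \<Rightarrow> real" where
  "riemann_dist P Q = sqrt (\<Sum>s \<in># eigvals (matrix_inv P ** Q). (ln s)^2)"

definition strictly_contractive :: "(real^'n^'n \<Rightarrow> real^'n^'n) \<Rightarrow> bool" where
  "strictly_contractive f \<longleftrightarrow>
     (\<forall>P. pos_def P \<longrightarrow> pos_def (f P)) \<and>
     (\<exists>c. 0 \<le> c \<and> c < 1 \<and>
        (\<forall>P Q. pos_def P \<longrightarrow> pos_def Q \<longrightarrow>
           riemann_dist (f P) (f Q) \<le> c * riemann_dist P Q))"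

definition vstack :: "real^'c^'a \<Rightarrow> real^'c^'b \<Rightarrow> real^'c^('a + 'b)" where
  "vstack X Y = (\<chi> i. case i of Inl a \<Rightarrow> X $ a | Inr b \<Rightarrow> Y $ b)"

definition bdiag :: "real^'a^'a \<Rightarrow> real^'b^'b \<Rightarrow> real^('a + 'b)^('a + 'b)" where
  "bdiag X Y = (\<chi> i j. case (i, j) of
      (Inl a, Inl a') \<Rightarrow> X $ a $ a'
    | (Inr b, Inr b') \<Rightarrow> Y $ b $ b'
    | _ \<Rightarrow> 0)"

text \<open>Rank conditions on \<open>[B, AB, \<dots>, A\<^sup>n\<^sup>-\<^sup>1B]\<close> and on the stacked \<open>C, CA, \<dots>, CA\<^sup>n\<^sup>-\<^sup>1\<close>.\<close>

definition reachable :: "real^'n^'n \<Rightarrow> real^'m^'n \<Rightarrow> bool" where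
  "reachable A B \<longleftrightarrow> dim (\<Union>k<CARD('n). columns (mpow A k ** B)) = CARD('n)"

definition observable :: "real^'n^'p \<Rightarrow> real^'n^'n \<Rightarrow> bool" where
  "observable C A \<longleftrightarrow> dim (\<Union>k<CARD('n). rows (C ** mpow A k)) = CARD('n)"


section \<open>Block matrices\<close>

text \<open>The \<open>N\<close> blocks are indexed by a finite linearly ordered type \<open>'k\<close> with \<open>N = CARD('k)\<close>, so
  that a block vector with \<open>N\<close> blocks of size \<open>r\<close> has index type \<open>'k \<times> 'r\<close>. Block positions
  \<open>blk i\<close> run over \<open>0, \<dots>, N - 1\<close>, hence are one less than the usual block numbers \<open>1, \<dots>, N\<close>.\<close>

definition blk :: "'k::{finite,linorder} \<Rightarrow> nat" where
  "blk i = card {j. j < i}"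

definition reach_mat :: "real^'n^'n \<Rightarrow> real^'m^'n \<Rightarrow> real^('k::{finite,linorder} \<times> 'm)^'n" where
  "reach_mat A B = (\<chi> a y. (mpow A (blk (fst y)) ** B) $ a $ snd y)"

definition obs_mat :: "real^'n^'r \<Rightarrow> real^'n^'n \<Rightarrow> real^'n^('k::{finite,linorder} \<times> 'r)" where
  "obs_mat C A = (\<chi> x. (C ** mpow A (CARD('k) - 1 - blk (fst x))) $ snd x)"

definition markov :: "real^'n^'r \<Rightarrow> real^'n^'n \<Rightarrow> real^'m^'n \<Rightarrow> int \<Rightarrow> real^'m^'r" where
  "markov C A B t = (if t \<ge> 1 then C ** mpow A (nat (t - 1)) ** B else 0)"

definition toep_mat ::
  "real^'n^'r \<Rightarrow> real^'n^'n \<Rightarrow> real^'m^'n \<Rightarrow> real^('k::{finite,linorder} \<times> 'm)^('k \<times> 'r)" where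
  "toep_mat C A B =
     (\<chi> x y. markov C A B (int (blk (fst y)) - int (blk (fst x))) $ snd x $ snd y)"

text \<open>With \<open>R = reach_mat A B\<close>, \<open>Ob = obs_mat C A\<close>, \<open>ObR = obs_mat D A\<close>, \<open>H = toep_mat C A B\<close>,
  \<open>L = toep_mat D A B\<close>; the \<open>'k itself\<close> argument carries the number of blocks.\<close>

definition theta_max ::
  "'k::{finite,linorder} itself \<Rightarrow> real^'n^'n \<Rightarrow> real^'m^'n \<Rightarrow> real^'n^'p \<Rightarrow> real^'n^'q \<Rightarrow> ereal" where
  "theta_max _ A B C D =
    (let H = toep_mat C A B :: real^('k \<times> 'm)^('k \<times> 'p);
         L = toep_mat D A B :: real^('k \<times> 'm)^('k \<times> 'q)
     in if L = 0 then \<infinity>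
        else ereal (1 / lambda1 (L ** matrix_inv (mat 1 + transpose H ** H) ** transpose L)))"

definition K_mat ::
  "real^'n^'n \<Rightarrow> real^'m^'n \<Rightarrow> real^'n^'p \<Rightarrow> real^'n^'q \<Rightarrow> real \<Rightarrow>
   real^(('k::{finite,linorder} \<times> 'p) + ('k \<times> 'q))^(('k \<times> 'p) + ('k \<times> 'q))" where
  "K_mat A B C D \<theta> =
    (let F = vstack (toep_mat C A B :: real^('k \<times> 'm)^('k \<times> 'p))
                    (toep_mat D A B :: real^('k \<times> 'm)^('k \<times> 'q))
     in bdiag (mat 1) (- ((1 / \<theta>) *\<^sub>R mat 1)) + F ** transpose F)"

definition K_inv ::
  "real^'n^'n \<Rightarrow> real^'m^'n \<Rightarrow> real^'n^'p \<Rightarrow> real^'n^'q \<Rightarrow> real \<Rightarrow>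
   real^(('k::{finite,linorder} \<times> 'p) + ('k \<times> 'q))^(('k \<times> 'p) + ('k \<times> 'q))" where
  "K_inv A B C D \<theta> =
    (if \<theta> = 0
     then (let H = toep_mat C A B :: real^('k \<times> 'm)^('k \<times> 'p)
           in bdiag (matrix_inv (mat 1 + H ** transpose H)) 0)
     else matrix_inv (K_mat A B C D \<theta>))"

text \<open>The row block \<open>[G, G\<^sup>R]\<close>, and its two parts.\<close>

definition gain_full ::
  "real^'n^'n \<Rightarrow> real^'m^'n \<Rightarrow> real^'n^'p \<Rightarrow> real^'n^'q \<Rightarrow> real \<Rightarrow>
   real^(('k::{finite,linorder} \<times> 'p) + ('k \<times> 'q))^('k \<times> 'm)" where
  "gain_full A B C D \<theta> =
    transpose (vstack (toep_mat C A B) (toep_mat D A B)) ** K_inv A B C D \<theta>"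

definition gain ::
  "real^'n^'n \<Rightarrow> real^'m^'n \<Rightarrow> real^'n^'p \<Rightarrow> real^'n^'q \<Rightarrow> real \<Rightarrow>
   real^('k::{finite,linorder} \<times> 'p)^('k \<times> 'm)" where
  "gain A B C D \<theta> = (\<chi> i j. gain_full A B C D \<theta> $ i $ Inl j)"

definition gainR ::
  "real^'n^'n \<Rightarrow> real^'m^'n \<Rightarrow> real^'n^'p \<Rightarrow> real^'n^'q \<Rightarrow> real \<Rightarrow>
   real^('k::{finite,linorder} \<times> 'q)^('k \<times> 'm)" where
  "gainR A B C D \<theta> = (\<chi> i j. gain_full A B C D \<theta> $ i $ Inr j)"

definition alpha_mat ::
  "'k::{finite,linorder} itself \<Rightarrow> real^'n^'n \<Rightarrow> real^'m^'n \<Rightarrow> real^'n^'p \<Rightarrow> real^'n^'q \<Rightarrow>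
   real \<Rightarrow> real^'n^'n" where
  "alpha_mat _ A B C D \<theta> =
    (let R = reach_mat A B :: real^('k \<times> 'm)^'n;
         Ob = obs_mat C A :: real^'n^('k \<times> 'p);
         ObR = obs_mat D A :: real^'n^('k \<times> 'q)
     in mpow A CARD('k) - R ** (gain A B C D \<theta> ** Ob + gainR A B C D \<theta> ** ObR))"

definition Omega_mat ::
  "'k::{finite,linorder} itself \<Rightarrow> real^'n^'n \<Rightarrow> real^'m^'n \<Rightarrow> real^'n^'p \<Rightarrow> real^'n^'q \<Rightarrow>
   real \<Rightarrow> real^'n^'n" where
  "Omega_mat _ A B C D \<theta> =
    (let Obs = vstack (obs_mat C A :: real^'n^('k \<times> 'p)) (obs_mat D A :: real^'n^('k \<times> 'q))
     in transpose Obs ** K_inv A B C D \<theta> ** Obs)"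

definition W_mat ::
  "'k::{finite,linorder} itself \<Rightarrow> real^'n^'n \<Rightarrow> real^'m^'n \<Rightarrow> real^'n^'p \<Rightarrow> real^'n^'q \<Rightarrow>
   real \<Rightarrow> real^'n^'n" where
  "W_mat _ A B C D \<theta> =
    (let R = reach_mat A B :: real^('k \<times> 'm)^'n;
         H = toep_mat C A B :: real^('k \<times> 'm)^('k \<times> 'p);
         L = toep_mat D A B :: real^('k \<times> 'm)^('k \<times> 'q)
     in R ** matrix_inv (mat 1 + transpose H ** H - \<theta> *\<^sub>R (transpose L ** L)) ** transpose R)"


section \<open>Riccati maps\<close>

definition riccati_block ::
  "'k::{finite,linorder} itself \<Rightarrow> real^'n^'n \<Rightarrow> real^'m^'n \<Rightarrow> real^'n^'p \<Rightarrow> real^'n^'q \<Rightarrow>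
   real \<Rightarrow> real^'n^'n \<Rightarrow> real^'n^'n" where
  "riccati_block k A B C D \<theta> P =
    alpha_mat k A B C D \<theta> ** matrix_inv (matrix_inv P + Omega_mat k A B C D \<theta>)
      ** transpose (alpha_mat k A B C D \<theta>) + W_mat k A B C D \<theta>"

definition riccati ::
  "real^'n^'n \<Rightarrow> real^'m^'n \<Rightarrow> real^'n^'p \<Rightarrow> real^'n^'q \<Rightarrow> real \<Rightarrow> real^'n^'n \<Rightarrow> real^'n^'n" where
  "riccati A B C D \<theta> P =
    A ** matrix_inv (matrix_inv P + transpose C ** C - \<theta> *\<^sub>R (transpose D ** D)) ** transpose A
      + B ** transpose B"

text \<open>Since \<^const>\<open>matrix_inv\<close> is total, the domain of \<^const>\<open>riccati\<close> has to be stated separately: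
  both inverses in its formula must exist. No sign condition on the bracket is imposed, so this
  is the largest domain on which the formula makes sense.\<close>

definition riccati_defined :: "real^'n^'n \<Rightarrow> real^'n^'p \<Rightarrow> real^'n^'q \<Rightarrow> real \<Rightarrow> bool" where
  "riccati_defined P C D \<theta> \<longleftrightarrow>
     invertible P \<and> invertible (matrix_inv P + transpose C ** C - \<theta> *\<^sub>R (transpose D ** D))"

definition riccati_iter_defined ::
  "nat \<Rightarrow> real^'n^'n \<Rightarrow> real^'m^'n \<Rightarrow> real^'n^'p \<Rightarrow> real^'n^'q \<Rightarrow> real \<Rightarrow> real^'n^'n \<Rightarrow> bool" where
  "riccati_iter_defined N A B C D \<theta> P \<longleftrightarrow>
     (\<forall>k<N. riccati_defined ((riccati A B C D \<theta> ^^ k) P) C D \<theta>)"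

end

theory Submission
  imports Defs
begin

text \<open>
  Over a block of \<open>N\<close> steps the Riccati recursion is the boundary value problem of a linear system
  \<open>\<xi>\<^sub>j = A \<xi>\<^sub>j\<^sub>+\<^sub>1 + B B\<^sup>T \<pi>\<^sub>j\<close>, \<open>\<pi>\<^sub>j\<^sub>+\<^sub>1 = A\<^sup>T \<pi>\<^sub>j - (C\<^sup>T C - \<theta> D\<^sup>T D) \<xi>\<^sub>j\<^sub>+\<^sub>1\<close> (time is counted backwards, as in the block
  matrices). Eliminating the \<open>N\<close> inputs \<open>B\<^sup>T \<pi>\<^sub>j\<close> means inverting
  \<open>M = I + H\<^sup>T H - \<theta> L\<^sup>T L\<close>. What remains is the relation \<open>\<xi>\<^sub>0 = \<alpha> \<xi>\<^sub>N + W \<pi>\<^sub>0\<close>,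
  \<open>\<pi>\<^sub>N = \<alpha>\<^sup>T \<pi>\<^sub>0 - \<Omega> \<xi>\<^sub>N\<close> (\<open>boundary_value_problem\<close>). Inserting \<open>\<xi>\<^sub>N = P \<pi>\<^sub>N\<close> gives the block map;
  inserting the iterates of \<open>r\<^sup>\<theta>\<close> one after the other gives its \<open>N\<close>-fold composition, so the two
  agree (\<open>riccati_iterate\<close>).

  Positivity. \<open>\<theta> < \<theta>\<^sub>N\<close> makes \<open>M\<close> positive definite (\<open>elim_mat_pos_def\<close>), and then \<open>W = R M\<^sup>-\<^sup>1 R\<^sup>T\<close> is
  positive definite by reachability. \<open>\<Omega>\<close> is a Schur complement: \<open>x\<^sup>T \<Omega> x\<close> is the minimum over \<open>u\<close> of
  \<open>q\<^sub>\<theta>(x,u) = |u|\<^sup>2 + |O x + H u|\<^sup>2 - \<theta> |O\<^sup>R x + L u|\<^sup>2\<close>. As \<open>q\<^sub>\<theta>\<close> is affine in \<open>\<theta>\<close> and, by observability,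
  \<open>q\<^sub>0\<close> is positive definite, the first \<open>\<theta>\<close> at which \<open>q\<^sub>\<theta>\<close> stops being positive definite is the reciprocal of a
  maximal Rayleigh quotient. At that value \<open>q\<^sub>\<theta>\<close> is still nonnegative and has a null vector, so \<open>\<Omega>\<close> is
  singular there; hence it cannot lie below \<open>\<tau>\<^sub>N\<close> (\<open>schur_mat_pos_def_before_singular\<close>).

  Contraction. For \<open>t > 1\<close> let \<open>f(Q) \<ge> t f(P)\<close> hold as forms on a subspace \<open>V\<close>. The injective map
  \<open>P\<^sup>-\<^sup>1 (P\<^sup>-\<^sup>1 + \<Omega>)\<^sup>-\<^sup>1 \<alpha>\<^sup>T\<close> carries \<open>V\<close> to a subspace where even \<open>Q \<ge> t\<^sup>1\<^sup>+\<^sup>\<delta> P\<close>, with a \<open>\<delta> > 0\<close> that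
  depends only on \<open>\<alpha>\<close>, \<open>\<Omega>\<close>, \<open>W\<close> (\<open>mobius_num_eigvals\<close>). The largest dimension of such a subspace is the
  number of eigenvalues of the pencil that are at least the given factor, so the logarithms of the eigenvalues, sorted,
  shrink in absolute value by the factor \<open>1 / (1 + \<delta>)\<close>. The fixed point is the limit of the increasing bounded sequence \<open>W, f(W), f(f(W)), \<dots>\<close>, and contraction makes it unique.
\<close>

section \<open>Matrices and quadratic forms\<close>

text \<open>Products with a transpose are kept in the form \<open>transpose A *v x\<close>, so that they combine with the
  associativity and transposition laws for \<open>**\<close>.\<close>

declare transpose_matrix_vector [simp del]

lemma transpose_add: "transpose (U + V) = transpose U + transpose (V :: real^'b^'a)"
  by (simp add: transpose_def vec_eq_iff)

lemma transpose_diff: "transpose (U - V) = transpose U - transpose (V :: real^'b^'a)"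
  by (simp add: transpose_def vec_eq_iff)

lemma dot_matrix_vector: "x \<bullet> (A *v y) = (transpose A *v x) \<bullet> (y :: real^'n)"
  by (simp add: dot_lmul_matrix transpose_matrix_vector)

lemma form_sym:
  fixes E :: "real^'n^'n"
  assumes "transpose E = E"
  shows "x \<bullet> (E *v y) = y \<bullet> (E *v x)"
  using assms dot_matrix_vector[of x E y] by (simp add: inner_commute)

lemma matrix_inv_right_left:
  fixes A :: "real^'n^'n"
  assumes "invertible A"
  shows "A ** matrix_inv A = mat 1" "matrix_inv A ** A = mat 1"
  using assms someI_ex[of "\<lambda>A'. A ** A' = mat 1 \<and> A' ** A = mat 1"]
  by (auto simp: matrix_inv_def invertible_def)

lemma matrix_inv_cancel:
  fixes A :: "real^'n^'n"
  assumes "invertible A"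
  shows "A *v (matrix_inv A *v x) = x" "matrix_inv A *v (A *v x) = x"
  using matrix_inv_right_left[OF assms] by (simp_all add: matrix_vector_mul_assoc)

lemma matrix_inv_unique:
  fixes A :: "real^'n^'n"
  assumes "A ** X = mat 1"
  shows "matrix_inv A = X"
proof -
  have "invertible A"
    using assms matrix_left_right_inverse invertible_def by blast
  then have "matrix_inv A ** (A ** X) = X"
    by (simp add: matrix_mul_assoc matrix_inv_right_left)
  then show ?thesis by (simp add: assms)
qed

lemma invertible_iff_ker:
  fixes A :: "real^'n^'n"
  shows "invertible A \<longleftrightarrow> (\<forall>x. A *v x = 0 \<longrightarrow> x = 0)"
  unfolding matrix_left_invertible_ker[symmetric] invertible_def
  using matrix_left_right_inverse by blast

lemma transpose_matrix_inv:
  fixes A :: "real^'n^'n"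
  assumes "invertible A" "transpose A = A"
  shows "transpose (matrix_inv A) = matrix_inv A"
proof -
  have "transpose (matrix_inv A ** A) = A ** transpose (matrix_inv A)"
    by (simp add: matrix_transpose_mul assms)
  then show ?thesis
    using matrix_inv_unique[of A "transpose (matrix_inv A)"] matrix_inv_right_left[OF assms(1)]
    by simp
qed

lemma pos_def_nonneg: "pos_def P \<Longrightarrow> 0 \<le> x \<bullet> (P *v x)"
  by (cases "x = 0") (auto simp: pos_def_def less_imp_le)

lemma pos_def_invertible: "pos_def P \<Longrightarrow> invertible P"
  unfolding invertible_iff_ker pos_def_def by (metis inner_zero_right less_irrefl)

lemma pos_def_matrix_inv:
  assumes "pos_def P"
  shows "pos_def (matrix_inv P)"
  unfolding pos_def_def
proof (intro conjI allI impI)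
  have inv: "invertible P" and sym: "transpose P = P"
    using assms pos_def_invertible by (auto simp: pos_def_def)
  show tr: "transpose (matrix_inv P) = matrix_inv P"
    using transpose_matrix_inv[OF inv sym] .
  fix x :: "real^'a" assume "x \<noteq> 0"
  let ?y = "matrix_inv P *v x"
  have "?y \<noteq> 0"
    using matrix_inv_cancel(1)[OF inv, of x] \<open>x \<noteq> 0\<close> by auto
  then have "0 < ?y \<bullet> (P *v ?y)"
    using assms by (auto simp: pos_def_def)
  then show "0 < x \<bullet> ?y"
    by (simp add: matrix_inv_cancel(1)[OF inv] inner_commute)
qed

lemma pos_def_add:
  "pos_def P \<Longrightarrow> pos_def Q \<Longrightarrow> pos_def (P + Q)"
  by (auto simp: pos_def_def transpose_def vec_eq_iff matrix_vector_mult_add_rdistrib inner_add_right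
      intro!: add_pos_pos)

lemma continuous_on_form: "continuous_on S (\<lambda>x. x \<bullet> (E *v (x :: real^'n)))"
  by (intro continuous_intros linear_continuous_on matrix_vector_mul_bounded_linear)

text \<open>Maximal Rayleigh quotients serve three purposes: they yield the eigenvectors of a pencil, the
  constant that bounds one form by another, and the first parameter at which a form degenerates. The
  last use lives on a product space, hence functions on a Euclidean space instead of matrices.\<close>

lemma rayleigh_max:
  fixes a b :: "'v::euclidean_space \<Rightarrow> real"
  assumes U: "subspace U" "U \<noteq> {0}"
    and ca: "continuous_on UNIV a" and cb: "continuous_on UNIV b"
    and ha: "\<And>c x. a (c *\<^sub>R x) = c\<^sup>2 * a x" and hb: "\<And>c x. b (c *\<^sub>R x) = c\<^sup>2 * b x"
    and pos: "\<And>x. x \<in> U \<Longrightarrow> x \<noteq> 0 \<Longrightarrow> 0 < a x"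
  obtains z where "z \<in> U" "z \<noteq> 0" "\<And>x. x \<in> U \<Longrightarrow> b x * a z \<le> b z * a x"
proof -
  let ?S = "U \<inter> sphere 0 1"
  have "0 \<in> U" using U(1) by (rule subspace_0)
  then obtain w where w: "w \<in> U" "w \<noteq> 0" using U(2) by auto
  have "(1 / norm w) *\<^sub>R w \<in> ?S"
    using w U(1) by (simp add: subspace_scale)
  then have "?S \<noteq> {}" by blast
  moreover have "compact ?S"
    using U(1) by (simp add: closed_Int_compact closed_subspace)
  moreover have "continuous_on ?S (\<lambda>x. b x / a x)"
    using pos by (intro continuous_on_divide continuous_on_subset[OF ca] continuous_on_subset[OF cb])
      force+
  ultimately obtain z where z: "z \<in> ?S" "\<And>x. x \<in> ?S \<Longrightarrow> b x / a x \<le> b z / a z"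
    using continuous_attains_sup[of ?S "\<lambda>x. b x / a x"] by metis
  have "z \<in> U" "z \<noteq> 0" using z(1) by auto
  moreover have "b x * a z \<le> b z * a x" if "x \<in> U" for x
  proof (cases "x = 0")
    case True
    then show ?thesis using ha[of 0 0] hb[of 0 0] by simp
  next
    case False
    define c where "c = 1 / norm x"
    have "c > 0" using False by (simp add: c_def)
    have "c *\<^sub>R x \<in> ?S" using False that U(1) by (simp add: subspace_scale c_def)
    then have "b x / a x \<le> b z / a z"
      using z(2)[of "c *\<^sub>R x"] \<open>c > 0\<close> by (simp add: ha hb)
    then show ?thesis
      using pos[OF that False] pos[OF \<open>z \<in> U\<close> \<open>z \<noteq> 0\<close>] by (simp add: field_simps)
  qed
  ultimately show ?thesis by (rule that)
qed

text \<open>A minimizer of a nonnegative form is a critical point. The step \<open>t\<close> below is close to the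
  minimizer of the quadratic polynomial \<open>t \<mapsto> (z + t h)\<^sup>T E (z + t h)\<close>, with \<open>d + 1\<close> in place of \<open>d\<close> to avoid
  a division by zero.\<close>

lemma psd_null_vector:
  fixes E :: "real^'n^'n"
  assumes sym: "transpose E = E" and U: "subspace U"
    and psd: "\<And>x. x \<in> U \<Longrightarrow> 0 \<le> x \<bullet> (E *v x)"
    and z: "z \<in> U" "z \<bullet> (E *v z) = 0" and h: "h \<in> U"
  shows "h \<bullet> (E *v z) = 0"
proof -
  define c where "c = h \<bullet> (E *v z)"
  define d where "d = h \<bullet> (E *v h)"
  define t where "t = - c / (d + 1)"
  have d: "0 \<le> d" using psd[OF h] by (simp add: d_def)
  have "z + t *\<^sub>R h \<in> U" using U z(1) h by (simp add: subspace_add subspace_scale)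
  from psd[OF this] have "0 \<le> 2 * t * c + t\<^sup>2 * d"
    using z(2) form_sym[OF sym, of z h]
    by (simp add: c_def d_def matrix_vector_right_distrib inner_add_left inner_add_right
        matrix_vector_mult_scaleR power2_eq_square algebra_simps)
  moreover have "2 * t * c + t\<^sup>2 * d = - (c\<^sup>2 * (d + 2)) / (d + 1)\<^sup>2"
    using d by (simp add: t_def power2_eq_square divide_simps) (simp add: algebra_simps)
  ultimately have "c\<^sup>2 * (d + 2) \<le> 0"
    using d by (simp add: divide_simps split: if_splits)
  then have "c = 0" using d by (simp add: mult_le_0_iff)
  then show ?thesis by (simp add: c_def)
qed

section \<open>Simultaneous diagonalization\<close>

text \<open>The spectral theorem for \<open>Q x = s P x\<close>. A maximizer \<open>z\<close> of \<open>x\<^sup>T Q x / x\<^sup>T P x\<close> on the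
  \<open>P\<close>-orthogonal complement \<open>U\<close> of the eigenvectors found so far is the next one: \<open>(\<mu> P - Q) z\<close> is orthogonal
  to \<open>U\<close> because \<open>z\<close> is critical there, and orthogonal to the old eigenvectors by symmetry.\<close>

lemma pencil_eigenvectors:
  fixes P Q :: "real^'n^'n"
  assumes P: "pos_def P" and Q: "transpose Q = Q"
  shows "k \<le> CARD('n) \<Longrightarrow> \<exists>(v :: nat \<Rightarrow> real^'n) s.
      (\<forall>i<k. \<forall>j<k. v i \<bullet> (P *v v j) = (if i = j then 1 else 0)) \<and>
      (\<forall>i<k. Q *v v i = s i *\<^sub>R (P *v v i))"
proof (induction k)
  case 0
  show ?case by simp
next
  case (Suc k)
  then obtain v :: "nat \<Rightarrow> real^'n" and s where
    v: "\<And>i j. i < k \<Longrightarrow> j < k \<Longrightarrow> v i \<bullet> (P *v v j) = (if i = j then 1 else 0)"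
    and s: "\<And>i. i < k \<Longrightarrow> Q *v v i = s i *\<^sub>R (P *v v i)"
    by auto
  have symP: "transpose P = P" using P by (simp add: pos_def_def)
  define U where "U = {x. \<forall>i<k. v i \<bullet> (P *v x) = 0}"
  have subU: "subspace U"
    by (auto simp: U_def subspace_def matrix_vector_right_distrib inner_add_right matrix_vector_mult_scaleR)
  have "dim ((\<lambda>i. P *v v i) ` {..<k}) \<le> card ((\<lambda>i. P *v v i) ` {..<k})"
    by (rule dim_le_card') simp
  also have "\<dots> \<le> k" using card_image_le[of "{..<k}" "\<lambda>i. P *v v i"] by simp
  also have "k < DIM(real^'n)" using Suc.prems by simp
  finally obtain x where x: "x \<noteq> 0"
    "\<And>y. y \<in> span ((\<lambda>i. P *v v i) ` {..<k}) \<Longrightarrow> orthogonal x y"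
    by (rule orthogonal_to_subspace_exists) blast
  have "x \<in> U"
    using x(2) form_sym[OF symP] by (auto simp: U_def orthogonal_def intro!: span_base)
  then have "U \<noteq> {0}" using x(1) by auto
  then obtain z where z: "z \<in> U" "z \<noteq> 0"
    and zmax: "\<And>x. x \<in> U \<Longrightarrow> (x \<bullet> (Q *v x)) * (z \<bullet> (P *v z)) \<le> (z \<bullet> (Q *v z)) * (x \<bullet> (P *v x))"
    using rayleigh_max[OF subU, of "\<lambda>x. x \<bullet> (P *v x)" "\<lambda>x. x \<bullet> (Q *v x)"] P
    by (auto simp: continuous_on_form matrix_vector_mult_scaleR power2_eq_square pos_def_def)
  define p where "p = z \<bullet> (P *v z)"
  define mu where "mu = (z \<bullet> (Q *v z)) / p"
  have p: "p > 0" using P z(2) by (auto simp: p_def pos_def_def)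
  define E where "E = mu *\<^sub>R P - Q"
  have E: "E *v y = mu *\<^sub>R (P *v y) - Q *v y" for y
    by (simp add: E_def matrix_vector_mult_diff_rdistrib scaleR_matrix_vector_assoc)
  have symE: "transpose E = E"
    using symP Q by (simp add: E_def transpose_def vec_eq_iff)
  have psd: "0 \<le> y \<bullet> (E *v y)" if "y \<in> U" for y
    using zmax[OF that] p by (simp add: E inner_diff_right mu_def p_def field_simps)
  have z0: "z \<bullet> (E *v z) = 0"
    using p by (simp add: E inner_diff_right mu_def p_def)
  have Ev: "v i \<bullet> (E *v z) = 0" if "i < k" for i
  proof -
    have "v i \<bullet> (P *v z) = 0" using z(1) that by (simp add: U_def)
    moreover have "v i \<bullet> (Q *v z) = s i * (v i \<bullet> (P *v z))"
      using form_sym[OF Q, of "v i" z] form_sym[OF symP, of "v i" z] s[OF that] by simp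
    ultimately show ?thesis by (simp add: E inner_diff_right)
  qed
  have "y \<bullet> (E *v z) = 0" for y
  proof -
    define y' where "y' = y - (\<Sum>i<k. (v i \<bullet> (P *v y)) *\<^sub>R v i)"
    have "v j \<bullet> (P *v y') = 0" if "j < k" for j
    proof -
      have "v j \<bullet> (P *v (\<Sum>i<k. (v i \<bullet> (P *v y)) *\<^sub>R v i)) =
          (\<Sum>i<k. (v i \<bullet> (P *v y)) * (v j \<bullet> (P *v v i)))"
        by (simp add: linear_sum[OF matrix_vector_mul_linear] inner_sum_right matrix_vector_mult_scaleR)
      also have "\<dots> = (\<Sum>i<k. if i = j then v j \<bullet> (P *v y) else 0)"
        using that by (intro sum.cong) (auto simp: v)
      also have "\<dots> = v j \<bullet> (P *v y)" using that by simp
      finally show ?thesis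
        by (simp add: y'_def matrix_vector_mult_diff_distrib inner_diff_right)
    qed
    then have "y' \<in> U" by (simp add: U_def)
    then have "y' \<bullet> (E *v z) = 0"
      using psd_null_vector[OF symE subU psd z(1) z0] by blast
    then show ?thesis
      by (simp add: y'_def inner_diff_left inner_sum_left Ev)
  qed
  then have "E *v z = 0" by (metis inner_eq_zero_iff)
  then have Qz: "Q *v z = mu *\<^sub>R (P *v z)" by (simp add: E)
  define w where "w = (1 / sqrt p) *\<^sub>R z"
  have "w \<bullet> (P *v w) = 1"
    using p by (simp add: w_def matrix_vector_mult_scaleR p_def[symmetric])
  moreover have "v i \<bullet> (P *v w) = 0" if "i < k" for i
    using z(1) that by (simp add: w_def U_def matrix_vector_mult_scaleR)
  moreover have "w \<bullet> (P *v v i) = 0" if "i < k" for i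
    using calculation(2)[OF that] form_sym[OF symP] by simp
  moreover have "Q *v w = mu *\<^sub>R (P *v w)"
    using Qz by (simp add: w_def matrix_vector_mult_scaleR)
  ultimately show ?case
    using v s by (intro exI[of _ "v(k := w)"] exI[of _ "s(k := mu)"]) (auto simp: less_Suc_eq)
qed

definition diag :: "('n \<Rightarrow> real) \<Rightarrow> real^'n^'n" where
  "diag s = (\<chi> i j. if i = j then s i else 0)"

lemma diag_vec: "(diag s *v y) $ i = s i * y $ i"
  by (simp add: diag_def matrix_vector_mult_def if_distrib[of "\<lambda>x. x * _"] cong: if_cong)

lemma matrix_mul_diag: "(M ** diag s) $ i $ j = s j * M $ i $ j"
  by (simp add: diag_def matrix_matrix_mult_def if_distrib[of "\<lambda>x. _ * x"] mult.commute cong: if_cong)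

lemma pencil_diagonalization:
  fixes P Q :: "real^'n^'n"
  assumes P: "pos_def P" and Q: "transpose Q = Q"
  obtains T :: "real^'n^'n" and s where "invertible T" "transpose T ** P ** T = mat 1" "Q ** T = P ** T ** diag s"
proof -
  obtain v :: "nat \<Rightarrow> real^'n" and s where
    v: "\<And>i j. i < CARD('n) \<Longrightarrow> j < CARD('n) \<Longrightarrow> v i \<bullet> (P *v v j) = (if i = j then 1 else 0)"
    and s: "\<And>i. i < CARD('n) \<Longrightarrow> Q *v v i = s i *\<^sub>R (P *v v i)"
    using pencil_eigenvectors[OF P Q, of "CARD('n)"] by auto
  obtain g :: "'n \<Rightarrow> nat" where g: "bij_betw g UNIV {..<CARD('n)}"
    using ex_bij_betw_finite_nat[of "UNIV :: 'n set"] by (auto simp: atLeast0LessThan)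
  then have gl: "g i < CARD('n)" for i by (auto simp: bij_betw_def)
  have gi: "g i = g j \<longleftrightarrow> i = j" for i j using g by (auto simp: bij_betw_def inj_on_def)
  define T :: "real^'n^'n" where "T = (\<chi> a i. v (g i) $ a)"
  have col: "column i T = v (g i)" for i by (simp add: T_def column_def vec_eq_iff)
  have colm: "column i (M ** T) = M *v v (g i)" for M :: "real^'n^'n" and i
    by (simp add: T_def column_def vec_eq_iff matrix_matrix_mult_def matrix_vector_mult_def)
  have "transpose T ** (P ** T) = mat 1"
  proof -
    have "(transpose T ** (P ** T)) $ i $ j = column i T \<bullet> column j (P ** T)" for i j
      by (subst matrix_matrix_mult_def) (simp add: transpose_def column_def inner_vec_def)
    then show ?thesis by (simp add: v gl gi mat_def vec_eq_iff colm col)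
  qed
  then have TPT: "transpose T ** P ** T = mat 1" by (simp add: matrix_mul_assoc)
  moreover from this have "invertible T"
    using matrix_left_right_inverse invertible_def by blast
  moreover have "Q ** T = P ** T ** diag (s \<circ> g)"
  proof -
    have "column i (Q ** T) = column i (P ** T ** diag (s \<circ> g))" for i
    proof -
      have "column i (P ** T ** diag (s \<circ> g)) = s (g i) *\<^sub>R column i (P ** T)"
        by (simp add: column_def vec_eq_iff matrix_mul_diag)
      then show ?thesis by (simp add: colm s gl)
    qed
    then show ?thesis by (simp add: column_def vec_eq_iff)
  qed
  ultimately show ?thesis using that by blast
qed

text \<open>The similarity is carried out over the polynomial ring, where the characteristic matrix of
  \<open>M\<close> is intertwined by \<open>T\<close> with that of the diagonal matrix. The determinant of \<open>T\<close> stays nonzero there and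
  cancels.\<close>

lemma eigvals_diagonalizable:
  fixes M T :: "real^'n^'n"
  assumes T: "invertible T" and MT: "M ** T = T ** diag s"
  shows "eigvals M = image_mset s (mset_set UNIV)"
proof -
  let ?X = "\<lambda>M :: real^'n^'n. (\<chi> i j. (if i = j then [:0, 1:] else 0) - [:M $ i $ j:]) :: (real poly)^'n^'n"
  define c :: "real^'n^'n \<Rightarrow> (real poly)^'n^'n" where "c M = (\<chi> i j. [:M $ i $ j:])" for M
  have pc: "(\<Sum>k\<in>K. [:f k:]) = [:\<Sum>k\<in>K. f k:]" for f :: "'n \<Rightarrow> real" and K
    by (induction K rule: infinite_finite_induct) auto
  have cm: "c (M ** N) = c M ** c N" for M N
    by (simp add: c_def vec_eq_iff matrix_matrix_mult_def pc[symmetric]) (simp add: mult.commute)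
  have X: "?X M = mat [:0, 1:] - c M" for M
    by (simp add: c_def mat_def vec_eq_iff)
  have dist: "(A - B) ** D = A ** D - B ** D" "D ** (A - B) = D ** A - D ** B"
    for A B D :: "(real poly)^'n^'n"
    by (simp_all add: vec_eq_iff matrix_matrix_mult_def algebra_simps sum_subtractf)
  have scal: "mat x ** A = A ** mat x" for x and A :: "(real poly)^'n^'n"
    by (simp add: vec_eq_iff matrix_matrix_mult_def mat_def if_distrib[of "\<lambda>x. x * _"]
        if_distrib[of "\<lambda>x. _ * x"] mult.commute cong: if_cong)
  have "?X M ** c T = c T ** ?X (diag s)"
    unfolding X dist scal cm[symmetric] MT ..
  from arg_cong[OF this, of det]
  have "det (?X M) * det (c T) = det (c T) * det (?X (diag s))"
    by (simp only: det_mul)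
  moreover have "det (c T) \<noteq> 0"
  proof -
    have "c (mat 1) = mat 1" by (auto simp: c_def mat_def vec_eq_iff)
    then have "c T ** c (matrix_inv T) = mat 1"
      by (metis cm matrix_inv_right_left(1)[OF T])
    then have "det (c T) * det (c (matrix_inv T)) = 1"
      by (metis det_mul det_I)
    then show ?thesis by auto
  qed
  ultimately have "det (?X M) = det (?X (diag s))" by simp
  also have "\<dots> = (\<Prod>i\<in>UNIV. ?X (diag s) $ i $ i)"
    by (rule det_diagonal) (simp add: diag_def)
  also have "\<dots> = (\<Prod>i\<in>UNIV. [:- s i, 1:])"
    by (simp add: diag_def)
  finally have "charpoly M = (\<Prod>i\<in>UNIV. [:- s i, 1:])"
    by (simp add: charpoly_def)
  then have "eigvals M = (\<Sum>i\<in>UNIV. {#s i#})"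
    by (simp add: eigvals_def proots_prod)
  also have "\<dots> = image_mset s (mset_set UNIV)"
  proof -
    have "(\<Sum>i\<in>A. {#s i#}) = image_mset s (mset_set A)" if "finite A" for A
      using that by induction auto
    then show ?thesis by simp
  qed
  finally show ?thesis .
qed

lemma dim_coordinate_subspace: "dim {y :: real^'n. \<forall>i. i \<notin> I \<longrightarrow> y $ i = 0} = card I"
  using dim_substandard_cart[of I, where 'a = real] by (simp add: dim_vec_eq)

lemma pencil_forms:
  fixes P Q T :: "real^'n^'n"
  assumes "transpose T ** P ** T = mat 1" "Q ** T = P ** T ** diag s"
  shows "(T *v y) \<bullet> (P *v (T *v y)) = (\<Sum>i\<in>UNIV. (y $ i)\<^sup>2)"
    and "(T *v y) \<bullet> (Q *v (T *v y)) = (\<Sum>i\<in>UNIV. s i * (y $ i)\<^sup>2)"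
proof -
  have P: "(T *v y) \<bullet> (P *v (T *v w)) = y \<bullet> w" for w
    using dot_matrix_vector[of y "transpose T" "P *v (T *v w)"] assms(1)
    by (simp add: matrix_vector_mul_assoc matrix_mul_assoc)
  show "(T *v y) \<bullet> (P *v (T *v y)) = (\<Sum>i\<in>UNIV. (y $ i)\<^sup>2)"
    unfolding P by (simp add: inner_vec_def power2_eq_square)
  have "Q *v (T *v y) = P *v (T *v (diag s *v y))"
    using assms(2) by (simp add: matrix_vector_mul_assoc matrix_mul_assoc)
  then show "(T *v y) \<bullet> (Q *v (T *v y)) = (\<Sum>i\<in>UNIV. s i * (y $ i)\<^sup>2)"
    by (simp add: P) (simp add: inner_vec_def diag_vec power2_eq_square ac_simps)
qed

lemma pencil_eigvals:
  fixes P Q T :: "real^'n^'n"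
  assumes P: "invertible P" and T: "invertible T" and QT: "Q ** T = P ** T ** diag s"
  shows "eigvals (matrix_inv P ** Q) = image_mset s (mset_set UNIV)"
proof (rule eigvals_diagonalizable[OF T])
  have "matrix_inv P ** (Q ** T) = matrix_inv P ** P ** T ** diag s"
    by (simp add: QT matrix_mul_assoc)
  then show "matrix_inv P ** Q ** T = T ** diag s"
    by (simp add: matrix_inv_right_left[OF P] matrix_mul_assoc)
qed

lemma size_filter_image_UNIV:
  "size (filter_mset p (image_mset s (mset_set (UNIV :: 'n::finite set)))) = card {i. p (s i)}"
  by (simp add: filter_mset_image_mset)

section \<open>Counting eigenvalues and the Riemann distance\<close>

definition num_eigvals_ge :: "real^'n^'n \<Rightarrow> real^'n^'n \<Rightarrow> real \<Rightarrow> nat" where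
  "num_eigvals_ge P Q t = size (filter_mset (\<lambda>s. t \<le> s) (eigvals (matrix_inv P ** Q)))"

text \<open>Together with the next lemma this is the Courant--Fischer principle in counting form: the
  number of eigenvalues \<open>\<ge> t\<close> of \<open>P\<^sup>-\<^sup>1 Q\<close> is the largest dimension of a subspace on which \<open>Q \<ge> t P\<close>. It
  reduces the comparison of two spectra to mapping subspaces injectively.\<close>

lemma num_eigvals_ge_attained:
  fixes P Q :: "real^'n^'n"
  assumes P: "pos_def P" and Q: "transpose Q = Q"
  obtains V where "subspace V" "dim V = num_eigvals_ge P Q t"
    "\<And>x. x \<in> V \<Longrightarrow> t * (x \<bullet> (P *v x)) \<le> x \<bullet> (Q *v x)"
proof -
  obtain T :: "real^'n^'n" and s where T: "invertible T" "transpose T ** P ** T = mat 1" "Q ** T = P ** T ** diag s"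
    by (rule pencil_diagonalization[OF P Q])
  define Y where "Y = {y :: real^'n. \<forall>i. i \<notin> {i. t \<le> s i} \<longrightarrow> y $ i = 0}"
  have Y: "subspace Y" by (auto simp: Y_def subspace_def)
  have inj: "inj ((*v) T)"
    using T(1) matrix_inv_cancel(2) by (metis injI)
  have "subspace ((*v) T ` Y)"
    by (rule linear_subspace_image[OF matrix_vector_mul_linear Y])
  moreover have "dim ((*v) T ` Y) = num_eigvals_ge P Q t"
    using dim_image_eq[OF matrix_vector_mul_linear, of T Y] inj dim_coordinate_subspace[of "{i. t \<le> s i}"]
    by (simp add: Y_def num_eigvals_ge_def pencil_eigvals[OF pos_def_invertible[OF P] T(1,3)]
        size_filter_image_UNIV inj_on_subset)
  moreover have "t * (x \<bullet> (P *v x)) \<le> x \<bullet> (Q *v x)" if "x \<in> (*v) T ` Y" for x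
  proof -
    from that obtain y where y: "x = T *v y" "y \<in> Y" by auto
    have "t * (y $ i)\<^sup>2 \<le> s i * (y $ i)\<^sup>2" for i
      using y(2) by (cases "t \<le> s i") (auto simp: Y_def mult_right_mono)
    then show ?thesis
      by (simp add: y(1) pencil_forms[OF T(2,3)] sum_distrib_left sum_mono)
  qed
  ultimately show ?thesis by (rule that)
qed

text \<open>The span of the eigenvectors with eigenvalue below \<open>t\<close> meets \<open>V\<close> only in \<open>0\<close>, because there
  \<open>Q < t P\<close>.\<close>

lemma dim_le_num_eigvals_ge:
  fixes P Q :: "real^'n^'n"
  assumes P: "pos_def P" and Q: "transpose Q = Q"
    and V: "subspace V" "\<And>x. x \<in> V \<Longrightarrow> t * (x \<bullet> (P *v x)) \<le> x \<bullet> (Q *v x)"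
  shows "dim V \<le> num_eigvals_ge P Q t"
proof -
  obtain T :: "real^'n^'n" and s where T: "invertible T" "transpose T ** P ** T = mat 1" "Q ** T = P ** T ** diag s"
    by (rule pencil_diagonalization[OF P Q])
  define Y where "Y = {y :: real^'n. \<forall>i. i \<notin> {i. s i < t} \<longrightarrow> y $ i = 0}"
  have Y: "subspace Y" by (auto simp: Y_def subspace_def)
  let ?W = "(*v) T ` Y"
  have inj: "inj ((*v) T)"
    using T(1) matrix_inv_cancel(2) by (metis injI)
  have W: "subspace ?W"
    by (rule linear_subspace_image[OF matrix_vector_mul_linear Y])
  have dW: "dim ?W = card {i. s i < t}"
    using dim_image_eq[OF matrix_vector_mul_linear, of T Y] inj dim_coordinate_subspace[of "{i. s i < t}"]
    by (simp add: Y_def inj_on_subset)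
  have "V \<inter> ?W \<subseteq> {0}"
  proof
    fix x assume x: "x \<in> V \<inter> ?W"
    then obtain y where y: "x = T *v y" "y \<in> Y" by auto
    have le: "s i * (y $ i)\<^sup>2 \<le> t * (y $ i)\<^sup>2" for i
      using y(2) by (cases "s i < t") (auto simp: Y_def mult_right_mono)
    have "(\<Sum>i\<in>UNIV. (t - s i) * (y $ i)\<^sup>2) \<le> 0"
      using V(2)[of x] x
      by (simp add: y(1) pencil_forms[OF T(2,3)] sum_distrib_left sum_subtractf left_diff_distrib)
    moreover have "0 \<le> (t - s i) * (y $ i)\<^sup>2" for i using le[of i] by (simp add: left_diff_distrib)
    ultimately have "(\<Sum>i\<in>UNIV. (t - s i) * (y $ i)\<^sup>2) = 0"
      by (intro antisym sum_nonneg) auto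
    then have "\<forall>i. (t - s i) * (y $ i)\<^sup>2 = 0"
      using \<open>\<And>i. 0 \<le> (t - s i) * (y $ i)\<^sup>2\<close> by (subst (asm) sum_nonneg_eq_0_iff) auto
    then have "y = 0" using y(2) by (auto simp: Y_def vec_eq_iff)
    then show "x \<in> {0}" by (simp add: y(1))
  qed
  then have "dim (V \<inter> ?W) = 0" by (simp only: dim_eq_0)
  then have "dim V + dim ?W = dim {x + y |x y. x \<in> V \<and> y \<in> ?W}"
    using dim_sums_Int[OF V(1) W] by linarith
  also have "\<dots> \<le> CARD('n)"
    using dim_subset_UNIV[of "{x + y |x y. x \<in> V \<and> y \<in> ?W}"] by simp
  also have "CARD('n) = card {i. t \<le> s i} + card {i. s i < t}"
  proof -
    have "UNIV = {i. t \<le> s i} \<union> {i. s i < t}" by auto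
    then show ?thesis by (metis (lifting) card_Un_disjoint disjoint_iff finite_code mem_Collect_eq not_le)
  qed
  finally show ?thesis
    by (simp add: dW num_eigvals_ge_def pencil_eigvals[OF pos_def_invertible[OF P] T(1,3)]
        size_filter_image_UNIV)
qed

lemma eigvals_pos:
  fixes P Q :: "real^'n^'n"
  assumes P: "pos_def P" and Q: "pos_def Q" and s: "\<sigma> \<in># eigvals (matrix_inv P ** Q)"
  shows "\<sigma> > 0"
proof -
  obtain T :: "real^'n^'n" and s where T: "invertible T" "transpose T ** P ** T = mat 1" "Q ** T = P ** T ** diag s"
    using pencil_diagonalization[OF P, of Q] Q unfolding pos_def_def by blast
  obtain i where i: "\<sigma> = s i"
    using s by (auto simp: pencil_eigvals[OF pos_def_invertible[OF P] T(1,3)])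
  have "T *v axis i 1 \<noteq> 0"
    using T(1) by (metis invertible_iff_ker axis_eq_0_iff zero_neq_one)
  then have "0 < (T *v axis i 1) \<bullet> (Q *v (T *v axis i 1))"
    using Q by (auto simp: pos_def_def)
  also have "\<dots> = s i"
    by (simp add: pencil_forms[OF T(2,3)] axis_def if_distrib[of "\<lambda>x. x\<^sup>2"] if_distrib[of "\<lambda>x. _ * x"] cong: if_cong)
  finally show ?thesis by (simp add: i)
qed

lemma eigvals_swap:
  fixes P Q :: "real^'n^'n"
  assumes P: "pos_def P" and Q: "pos_def Q"
  shows "eigvals (matrix_inv Q ** P) = image_mset inverse (eigvals (matrix_inv P ** Q))"
proof -
  obtain T :: "real^'n^'n" and s where T: "invertible T" "transpose T ** P ** T = mat 1" "Q ** T = P ** T ** diag s"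
    using pencil_diagonalization[OF P, of Q] Q unfolding pos_def_def by blast
  note eP = pencil_eigvals[OF pos_def_invertible[OF P] T(1,3)]
  have "s i > 0" for i
    using eigvals_pos[OF P Q, of "s i"] by (simp add: eP)
  then have s: "s i \<noteq> 0" for i by (metis less_irrefl)
  have "P ** T = Q ** T ** diag (\<lambda>i. inverse (s i))"
    by (simp add: T(3) vec_eq_iff matrix_mul_diag s)
  from pencil_eigvals[OF pos_def_invertible[OF Q] T(1) this] show ?thesis
    by (simp add: eP multiset.map_comp comp_def)
qed

lemma sum_mset_nonneg_real:
  "(\<And>x. x \<in># X \<Longrightarrow> 0 \<le> f x) \<Longrightarrow> (0 :: real) \<le> (\<Sum>x\<in>#X. f x)"
  by (induction X) auto

text \<open>Domination of the counting functions means domination of the sorted positive entries, largest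
  first; accordingly the induction removes the maximum on both sides.\<close>

lemma sum_pos_part_squares_le:
  fixes X Y :: "real multiset"
  assumes "\<And>u. u > 0 \<Longrightarrow> size (filter_mset (\<lambda>x. u \<le> x) X) \<le> size (filter_mset (\<lambda>x. u \<le> x) Y)"
  shows "(\<Sum>x\<in>#X. (max 0 x)\<^sup>2) \<le> (\<Sum>y\<in>#Y. (max 0 y)\<^sup>2)"
  using assms
proof (induction "size X" arbitrary: X Y)
  case 0
  then show ?case by (simp add: sum_mset_nonneg_real)
next
  case (Suc n)
  then have X: "X \<noteq> {#}" by auto
  define x where "x = Max (set_mset X)"
  have x: "x \<in># X" "\<And>x'. x' \<in># X \<Longrightarrow> x' \<le> x"
    using X by (auto simp: x_def)
  show ?case
  proof (cases "x > 0")
    case False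
    then have "(\<Sum>x\<in>#X. (max 0 x)\<^sup>2) = (\<Sum>x\<in>#X. 0)"
      using x(2) by (intro arg_cong[of _ _ sum_mset] image_mset_cong) fastforce
    then show ?thesis by (simp add: sum_mset_nonneg_real)
  next
    case True
    have "x \<in># filter_mset (\<lambda>x'. x \<le> x') X" using x(1) by simp
    then have "0 < size (filter_mset (\<lambda>x'. x \<le> x') X)"
      by (metis gr0I size_eq_0_iff_empty empty_iff set_mset_empty)
    then have "0 < size (filter_mset (\<lambda>x'. x \<le> x') Y)"
      using Suc.prems[OF True] by linarith
    then obtain y0 where "y0 \<in># filter_mset (\<lambda>x'. x \<le> x') Y"
      by (metis size_empty less_irrefl multiset_nonemptyE)
    then have y0: "y0 \<in># Y" "x \<le> y0" by auto
    define y where "y = Max (set_mset Y)"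
    have y: "y \<in># Y" "\<And>y'. y' \<in># Y \<Longrightarrow> y' \<le> y"
      unfolding y_def using y0(1) by (force intro!: Max_in Max_ge)+
    have xy: "x \<le> y" using y0 y(2) by force
    obtain X' where X': "X = add_mset x X'" using x(1) by (metis mset_add)
    obtain Y' where Y': "Y = add_mset y Y'" using y(1) by (metis mset_add)
    have "(\<Sum>x\<in>#X'. (max 0 x)\<^sup>2) \<le> (\<Sum>y\<in>#Y'. (max 0 y)\<^sup>2)"
    proof (rule Suc.hyps(1))
      show "n = size X'" using Suc.hyps(2) X' by simp
      fix u :: real assume u: "u > 0"
      show "size (filter_mset (\<lambda>x. u \<le> x) X') \<le> size (filter_mset (\<lambda>x. u \<le> x) Y')"
      proof (cases "u \<le> x")
        case True
        then show ?thesis using Suc.prems[OF u] xy by (simp add: X' Y')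
      next
        case False
        have "filter_mset (\<lambda>x. u \<le> x) X' = {#}"
          using x(2) False by (subst set_mset_eq_empty_iff[symmetric]) (force simp: X')
        then show ?thesis by (simp only: size_empty)
      qed
    qed
    moreover have "(max 0 x)\<^sup>2 \<le> (max 0 y)\<^sup>2"
      using xy True by (intro power_mono) auto
    ultimately show ?thesis unfolding X' Y' image_mset_add_mset sum_mset.add_mset
      by (intro add_mono)
  qed
qed

text \<open>The squared distance splits into the eigenvalues above \<open>1\<close> and those below \<open>1\<close>, and the
  latter are the reciprocals of the eigenvalues above \<open>1\<close> of the swapped pencil. So only factors \<open>t > 1\<close> have to be compared.\<close>

definition pos_log_sum :: "real^'n^'n \<Rightarrow> real^'n^'n \<Rightarrow> real" where
  "pos_log_sum P Q = (\<Sum>s\<in>#eigvals (matrix_inv P ** Q). (max 0 (ln s))\<^sup>2)"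

lemma riemann_dist_pos_log_sum:
  fixes P Q :: "real^'n^'n"
  assumes "pos_def P" "pos_def Q"
  shows "riemann_dist P Q = sqrt (pos_log_sum P Q + pos_log_sum Q P)"
proof -
  have "pos_log_sum Q P = (\<Sum>s\<in>#eigvals (matrix_inv P ** Q). (max 0 (ln (inverse s)))\<^sup>2)"
    by (simp add: pos_log_sum_def eigvals_swap[OF assms] multiset.map_comp comp_def)
  also have "\<dots> = (\<Sum>s\<in>#eigvals (matrix_inv P ** Q). (max 0 (- ln s))\<^sup>2)"
    by (intro arg_cong[of _ _ sum_mset] image_mset_cong) (simp add: ln_inverse eigvals_pos[OF assms])
  finally have "pos_log_sum P Q + pos_log_sum Q P =
      (\<Sum>s\<in>#eigvals (matrix_inv P ** Q). (max 0 (ln s))\<^sup>2 + (max 0 (- ln s))\<^sup>2)"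
    by (simp add: pos_log_sum_def sum_mset.distrib)
  also have "\<dots> = (\<Sum>s\<in>#eigvals (matrix_inv P ** Q). (ln s)\<^sup>2)"
    by (intro arg_cong[of _ _ sum_mset] image_mset_cong) (auto simp: max_def)
  finally show ?thesis by (simp add: riemann_dist_def)
qed

lemma pos_log_sum_nonneg: "0 \<le> pos_log_sum P Q"
  by (simp add: pos_log_sum_def sum_mset_nonneg_real)

lemma pos_log_sum_contract:
  fixes P Q P' Q' :: "real^'n^'n"
  assumes pd: "pos_def P" "pos_def Q" "pos_def P'" "pos_def Q'" and \<gamma>: "\<gamma> > 0"
    and num: "\<And>t. t > 1 \<Longrightarrow> num_eigvals_ge P' Q' t \<le> num_eigvals_ge P Q (t powr \<gamma>)"
  shows "pos_log_sum P' Q' \<le> (1 / \<gamma>)\<^sup>2 * pos_log_sum P Q"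
proof -
  let ?X = "image_mset ln (eigvals (matrix_inv P' ** Q'))"
  let ?Y = "image_mset (\<lambda>s. ln s / \<gamma>) (eigvals (matrix_inv P ** Q))"
  have "(\<Sum>x\<in>#?X. (max 0 x)\<^sup>2) \<le> (\<Sum>y\<in>#?Y. (max 0 y)\<^sup>2)"
  proof (rule sum_pos_part_squares_le)
    fix u :: real assume "u > 0"
    have "filter_mset (\<lambda>s. u \<le> ln s) (eigvals (matrix_inv P' ** Q')) =
        filter_mset (\<lambda>s. exp u \<le> s) (eigvals (matrix_inv P' ** Q'))"
      by (intro filter_mset_cong refl) (use eigvals_pos[OF pd(3,4)] ln_ge_iff in blast)
    then have "size (filter_mset (\<lambda>x. u \<le> x) ?X) = num_eigvals_ge P' Q' (exp u)"
      by (simp add: filter_mset_image_mset num_eigvals_ge_def)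
    also have "\<dots> \<le> num_eigvals_ge P Q (exp u powr \<gamma>)"
      using \<open>u > 0\<close> by (intro num) simp
    also have "\<dots> = size (filter_mset (\<lambda>x. u \<le> x) ?Y)"
    proof -
      have "filter_mset (\<lambda>s. u \<le> ln s / \<gamma>) (eigvals (matrix_inv P ** Q)) =
          filter_mset (\<lambda>s. exp u powr \<gamma> \<le> s) (eigvals (matrix_inv P ** Q))"
      proof (intro filter_mset_cong refl)
        fix s assume "s \<in># eigvals (matrix_inv P ** Q)"
        then have "s > 0" using eigvals_pos[OF pd(1,2)] by blast
        then show "u \<le> ln s / \<gamma> \<longleftrightarrow> exp u powr \<gamma> \<le> s"
          using \<gamma> by (simp add: powr_def ln_ge_iff[symmetric] field_simps)
      qed
      then show ?thesis by (simp add: filter_mset_image_mset num_eigvals_ge_def)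
    qed
    finally show "size (filter_mset (\<lambda>x. u \<le> x) ?X) \<le> size (filter_mset (\<lambda>x. u \<le> x) ?Y)" .
  qed
  then have "pos_log_sum P' Q' \<le> (\<Sum>s\<in>#eigvals (matrix_inv P ** Q). (max 0 (ln s / \<gamma>))\<^sup>2)"
    by (simp add: pos_log_sum_def multiset.map_comp comp_def)
  also have "(\<lambda>s. (max 0 (ln s / \<gamma>))\<^sup>2) = (\<lambda>s. (1 / \<gamma>)\<^sup>2 * (max 0 (ln s))\<^sup>2)"
    using \<gamma> by (auto simp: max_def field_simps zero_le_divide_iff)
  finally show ?thesis by (simp add: pos_log_sum_def sum_mset_distrib_left)
qed

lemma riemann_dist_contract:
  fixes P Q P' Q' :: "real^'n^'n"
  assumes pd: "pos_def P" "pos_def Q" "pos_def P'" "pos_def Q'" and \<gamma>: "\<gamma> > 0"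
    and "\<And>t. t > 1 \<Longrightarrow> num_eigvals_ge P' Q' t \<le> num_eigvals_ge P Q (t powr \<gamma>)"
    and "\<And>t. t > 1 \<Longrightarrow> num_eigvals_ge Q' P' t \<le> num_eigvals_ge Q P (t powr \<gamma>)"
  shows "riemann_dist P' Q' \<le> (1 / \<gamma>) * riemann_dist P Q"
proof -
  have "riemann_dist P' Q' \<le> sqrt ((1 / \<gamma>)\<^sup>2 * (pos_log_sum P Q + pos_log_sum Q P))"
    unfolding riemann_dist_pos_log_sum[OF pd(3,4)]
    using pos_log_sum_contract[OF pd \<gamma> assms(6)] pos_log_sum_contract[OF pd(2,1,4,3) \<gamma> assms(7)]
    by (intro real_sqrt_le_mono) (simp add: distrib_left)
  also have "\<dots> = (1 / \<gamma>) * riemann_dist P Q"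
    unfolding riemann_dist_pos_log_sum[OF pd(1,2)] real_sqrt_mult using \<gamma> by simp
  finally show ?thesis .
qed

lemma riemann_dist_eq_0:
  fixes P Q :: "real^'n^'n"
  assumes pd: "pos_def P" "pos_def Q" and 0: "riemann_dist P Q = 0"
  shows "P = Q"
proof -
  obtain T :: "real^'n^'n" and s where T: "invertible T" "transpose T ** P ** T = mat 1" "Q ** T = P ** T ** diag s"
    using pencil_diagonalization[OF pd(1), of Q] pd(2) unfolding pos_def_def by blast
  note eP = pencil_eigvals[OF pos_def_invertible[OF pd(1)] T(1,3)]
  have "(\<Sum>i\<in>UNIV. (ln (s i))\<^sup>2) = 0"
    using 0 by (simp add: riemann_dist_def eP multiset.map_comp comp_def sum_unfold_sum_mset)
  then have "ln (s i) = 0" for i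
    by (subst (asm) sum_nonneg_eq_0_iff) auto
  moreover have "s i > 0" for i
    using eigvals_pos[OF pd, of "s i"] by (simp add: eP)
  ultimately have "s i = 1" for i by (metis ln_eq_zero_iff)
  then have "Q ** T = P ** T"
    by (simp add: T(3) vec_eq_iff matrix_mul_diag)
  then have "Q ** T ** matrix_inv T = P ** T ** matrix_inv T" by simp
  then show ?thesis
    by (simp add: matrix_mul_assoc[symmetric] matrix_inv_right_left[OF T(1)])
qed

section \<open>Contraction of Riccati-type maps\<close>

lemma pos_def_dominates:
  fixes W G :: "real^'n^'n"
  assumes W: "pos_def W"
  obtains \<beta> where "\<beta> > 0" "\<And>x. x \<bullet> (G *v x) \<le> \<beta> * (x \<bullet> (W *v x))"
proof -
  have "axis undefined 1 \<noteq> (0 :: real^'n)" by (simp add: axis_eq_0_iff)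
  then have "(UNIV :: (real^'n) set) \<noteq> {0}" by auto
  then obtain z where z: "z \<noteq> 0" "\<And>x. (x \<bullet> (G *v x)) * (z \<bullet> (W *v z)) \<le> (z \<bullet> (G *v z)) * (x \<bullet> (W *v x))"
    using rayleigh_max[of "UNIV :: (real^'n) set" "\<lambda>x. x \<bullet> (W *v x)" "\<lambda>x. x \<bullet> (G *v x)"] W
    by (auto simp: continuous_on_form matrix_vector_mult_scaleR power2_eq_square pos_def_def)
  have p: "0 < z \<bullet> (W *v z)" using W z(1) by (auto simp: pos_def_def)
  define \<beta> where "\<beta> = max 1 ((z \<bullet> (G *v z)) / (z \<bullet> (W *v z)))"
  have "x \<bullet> (G *v x) \<le> \<beta> * (x \<bullet> (W *v x))" for x
  proof -
    have "x \<bullet> (G *v x) \<le> (z \<bullet> (G *v z)) / (z \<bullet> (W *v z)) * (x \<bullet> (W *v x))"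
      using z(2)[of x] p by (simp add: field_simps)
    also have "\<dots> \<le> \<beta> * (x \<bullet> (W *v x))"
      using pos_def_nonneg[OF W] by (intro mult_right_mono) (auto simp: \<beta>_def)
    finally show ?thesis .
  qed
  moreover have "\<beta> > 0" by (simp add: \<beta>_def)
  ultimately show ?thesis using that by blast
qed

text \<open>The parallel sum of \<open>P\<close> and \<open>\<Omega>\<^sup>-\<^sup>1\<close>, with the variational characterization
  \<open>y\<^sup>T (P\<^sup>-\<^sup>1 + \<Omega>)\<^sup>-\<^sup>1 y = min {z\<^sup>T P z + v\<^sup>T \<Omega>\<^sup>-\<^sup>1 v | y = z + v}\<close> provided by \<open>par_sum_form\<close> and \<open>par_sum_le\<close>.\<close>

definition par_sum :: "real^'n^'n \<Rightarrow> real^'n^'n \<Rightarrow> real^'n^'n" where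
  "par_sum \<Omega> P = matrix_inv (matrix_inv P + \<Omega>)"

lemma pos_def_par_sum: "pos_def \<Omega> \<Longrightarrow> pos_def P \<Longrightarrow> pos_def (par_sum \<Omega> P)"
  by (simp add: par_sum_def pos_def_matrix_inv pos_def_add)

lemma par_sum_split:
  assumes "pos_def \<Omega>" "pos_def P"
  shows "y = matrix_inv P *v (par_sum \<Omega> P *v y) + \<Omega> *v (par_sum \<Omega> P *v y)"
  using matrix_inv_cancel(1)[OF pos_def_invertible[OF pos_def_add[OF pos_def_matrix_inv[OF assms(2)] assms(1)]], of y]
  by (simp add: par_sum_def matrix_vector_mult_add_rdistrib)

lemma par_sum_form:
  assumes \<Omega>: "pos_def \<Omega>" and P: "pos_def P"
  defines "z \<equiv> \<lambda>y. matrix_inv P *v (par_sum \<Omega> P *v y)" and "v \<equiv> \<lambda>y. \<Omega> *v (par_sum \<Omega> P *v y)"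
  shows "y \<bullet> (par_sum \<Omega> P *v y) = z y \<bullet> (P *v z y) + v y \<bullet> (matrix_inv \<Omega> *v v y)"
proof -
  have "z y \<bullet> (P *v z y) + v y \<bullet> (matrix_inv \<Omega> *v v y) = (z y + v y) \<bullet> (par_sum \<Omega> P *v y)"
    by (simp add: z_def v_def matrix_inv_cancel pos_def_invertible[OF P] pos_def_invertible[OF \<Omega>] inner_add_left)
  then show ?thesis using par_sum_split[OF \<Omega> P, of y] by (simp add: z_def v_def)
qed

text \<open>Young's inequality for a pair of dual forms, from expanding the form of \<open>P\<close> at \<open>z - P\<^sup>-\<^sup>1 g\<close>.\<close>

lemma young_form:
  assumes P: "pos_def P"
  shows "2 * (z \<bullet> g) \<le> z \<bullet> (P *v z) + g \<bullet> (matrix_inv P *v g)"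
proof -
  let ?h = "matrix_inv P *v g"
  have Ph: "P *v ?h = g" using P by (simp add: matrix_inv_cancel pos_def_invertible)
  have "0 \<le> (z - ?h) \<bullet> (P *v (z - ?h))" by (rule pos_def_nonneg[OF P])
  also have "\<dots> = z \<bullet> (P *v z) - z \<bullet> g - ?h \<bullet> (P *v z) + ?h \<bullet> g"
    by (simp add: matrix_vector_mult_diff_distrib inner_diff_left inner_diff_right Ph)
  also have "?h \<bullet> (P *v z) = z \<bullet> g"
    using form_sym[of P ?h z] P by (simp add: pos_def_def Ph)
  finally show ?thesis by (simp add: inner_commute)
qed

lemma par_sum_le:
  assumes \<Omega>: "pos_def \<Omega>" and P: "pos_def P"
  shows "(z + v) \<bullet> (par_sum \<Omega> P *v (z + v)) \<le> z \<bullet> (P *v z) + v \<bullet> (matrix_inv \<Omega> *v v)"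
proof -
  define g where "g = par_sum \<Omega> P *v (z + v)"
  have iO: "matrix_inv (matrix_inv \<Omega>) = \<Omega>"
    by (rule matrix_inv_unique) (simp add: matrix_inv_right_left pos_def_invertible[OF \<Omega>])
  have "2 * (z \<bullet> g) \<le> z \<bullet> (P *v z) + g \<bullet> (matrix_inv P *v g)"
    by (rule young_form[OF P])
  moreover have "2 * (v \<bullet> g) \<le> v \<bullet> (matrix_inv \<Omega> *v v) + g \<bullet> (\<Omega> *v g)"
    using young_form[OF pos_def_matrix_inv[OF \<Omega>], of v g] by (simp add: iO)
  moreover have "g \<bullet> (matrix_inv P *v g) + g \<bullet> (\<Omega> *v g) = g \<bullet> (z + v)"
    using par_sum_split[OF \<Omega> P, of "z + v"] by (simp add: g_def inner_add_right[symmetric])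
  ultimately show ?thesis
    by (simp add: g_def[symmetric] inner_add_left inner_add_right inner_commute)
qed

definition mobius :: "real^'n^'n \<Rightarrow> real^'n^'n \<Rightarrow> real^'n^'n \<Rightarrow> real^'n^'n \<Rightarrow> real^'n^'n" where
  "mobius \<alpha> \<Omega> W P = \<alpha> ** par_sum \<Omega> P ** transpose \<alpha> + W"

lemma mobius_form:
  "x \<bullet> (mobius \<alpha> \<Omega> W P *v x) = (transpose \<alpha> *v x) \<bullet> (par_sum \<Omega> P *v (transpose \<alpha> *v x)) + x \<bullet> (W *v x)"
  by (simp add: mobius_def matrix_vector_mult_add_rdistrib inner_add_right matrix_vector_mul_assoc[symmetric]
      dot_matrix_vector[of x \<alpha>])

lemma mobius_pos_def:
  assumes "pos_def \<Omega>" "pos_def W" "pos_def P"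
  shows "pos_def (mobius \<alpha> \<Omega> W P)"
  unfolding pos_def_def
proof (intro conjI allI impI)
  have "transpose (par_sum \<Omega> P) = par_sum \<Omega> P" "transpose W = W"
    using pos_def_par_sum[OF assms(1,3)] assms(2) by (auto simp: pos_def_def)
  then show "transpose (mobius \<alpha> \<Omega> W P) = mobius \<alpha> \<Omega> W P"
    by (simp add: mobius_def transpose_add matrix_transpose_mul matrix_mul_assoc)
  fix x :: "real^'a" assume "x \<noteq> 0"
  then show "0 < x \<bullet> (mobius \<alpha> \<Omega> W P *v x)"
    unfolding mobius_form
    using assms(2) pos_def_nonneg[OF pos_def_par_sum[OF assms(1,3)]]
    by (intro add_nonneg_pos) (auto simp: pos_def_def)
qed

text \<open>The hypothesis reads \<open>a (1 - (t - 1) \<delta>) \<ge> t b\<close>, and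
  \<open>ln (1 - (t - 1) \<delta>) \<le> - (t - 1) \<delta> \<le> - \<delta> ln t\<close>; so dividing by the bracket gains the factor \<open>t\<^sup>\<delta>\<close>.\<close>

lemma powr_one_plus_bound:
  fixes a b \<delta> t :: real
  assumes "a \<ge> t * b + (t - 1) * (\<delta> * a)" "a \<ge> 0" "b > 0" "t > 1" "\<delta> > 0"
  shows "a \<ge> t powr (1 + \<delta>) * b"
proof -
  define c where "c = 1 - (t - 1) * \<delta>"
  have ac: "t * b \<le> a * c" using assms(1) by (simp add: c_def algebra_simps)
  have tb: "t * b > 0" using assms by simp
  then have c: "c > 0"
    using ac assms(2) by (meson less_le_trans mult_nonneg_nonpos not_le)
  have "\<delta> * ln t \<le> \<delta> * (t - 1)" using assms(4,5) by (simp add: ln_le_minus_one)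
  also have "\<dots> \<le> - ln c" using ln_le_minus_one[OF c] by (simp add: c_def algebra_simps)
  finally have "exp (\<delta> * ln t + ln c) \<le> 1" by simp
  then have pc: "t powr \<delta> * c \<le> 1"
    using c assms(4) by (simp add: powr_def exp_add)
  have "t powr (1 + \<delta>) * b = t powr \<delta> * (t * b)" using assms(4) by (simp add: powr_add)
  also have "\<dots> \<le> t powr \<delta> * (a * c)" using ac by (intro mult_left_mono) auto
  also have "\<dots> = a * (t powr \<delta> * c)" by simp
  also have "\<dots> \<le> a" using mult_left_mono[OF pc assms(2)] by simp
  finally show ?thesis .
qed

text \<open>The heart of the contraction. On \<open>V\<close> put \<open>y = \<alpha>\<^sup>T x\<close> and split \<open>y = z + v\<close> optimally for \<open>P\<close>.
  The summand \<open>W\<close> pulls the ratio of the two values towards \<open>1\<close>, by a definite amount because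
  \<open>x\<^sup>T W x \<ge> \<delta> y\<^sup>T \<Omega>\<^sup>-\<^sup>1 y\<close>; this turns \<open>t\<close> into \<open>t\<^sup>1\<^sup>+\<^sup>\<delta>\<close>. Using the same splitting for \<open>Q\<close>, where it need not
  be optimal, transfers the inequality from \<open>y\<close> to \<open>z\<close>. Injectivity of \<open>x \<mapsto> z\<close> on \<open>V\<close> follows from \<open>t > 1\<close>
  and \<open>W > 0\<close>, even if \<open>\<alpha>\<close> is singular.\<close>

lemma mobius_num_eigvals:
  fixes \<Omega> W P Q \<alpha> :: "real^'n^'n"
  assumes \<Omega>: "pos_def \<Omega>" and W: "pos_def W" and P: "pos_def P" and Q: "pos_def Q"
    and \<delta>: "\<delta> > 0"
      "\<And>x. \<delta> * ((transpose \<alpha> *v x) \<bullet> (matrix_inv \<Omega> *v (transpose \<alpha> *v x))) \<le> x \<bullet> (W *v x)"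
    and t: "t > 1"
  shows "num_eigvals_ge (mobius \<alpha> \<Omega> W P) (mobius \<alpha> \<Omega> W Q) t \<le> num_eigvals_ge P Q (t powr (1 + \<delta>))"
proof -
  have sym: "transpose (mobius \<alpha> \<Omega> W Q) = mobius \<alpha> \<Omega> W Q" "transpose Q = Q"
    using mobius_pos_def[OF \<Omega> W Q] Q by (auto simp: pos_def_def)
  obtain V where V: "subspace V" "dim V = num_eigvals_ge (mobius \<alpha> \<Omega> W P) (mobius \<alpha> \<Omega> W Q) t"
    and Vt: "\<And>x. x \<in> V \<Longrightarrow> t * (x \<bullet> (mobius \<alpha> \<Omega> W P *v x)) \<le> x \<bullet> (mobius \<alpha> \<Omega> W Q *v x)"
    using num_eigvals_ge_attained[OF mobius_pos_def[OF \<Omega> W P] sym(1)] by blast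
  \<comment> \<open>Maps \<open>x\<close> to the first component of the optimal splitting of \<open>\<alpha>\<^sup>T x\<close> for \<open>P\<close>.\<close>
  define Z where "Z = matrix_inv P ** par_sum \<Omega> P ** transpose \<alpha>"
  have inv: "invertible (matrix_inv P)" "invertible (par_sum \<Omega> P)"
    using P \<Omega> by (auto intro: pos_def_invertible pos_def_matrix_inv pos_def_par_sum)
  have key: "Z *v x \<noteq> 0 \<and>
      t powr (1 + \<delta>) * ((Z *v x) \<bullet> (P *v (Z *v x))) \<le> (Z *v x) \<bullet> (Q *v (Z *v x))"
    if x: "x \<in> V" "x \<noteq> 0" for x
  proof -
    define y where "y = transpose \<alpha> *v x"
    define v where "v = \<Omega> *v (par_sum \<Omega> P *v y)"
    have Z: "Z *v x = matrix_inv P *v (par_sum \<Omega> P *v y)"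
      by (simp add: Z_def y_def matrix_vector_mul_assoc matrix_mul_assoc)
    have y: "y = Z *v x + v" unfolding Z v_def by (rule par_sum_split[OF \<Omega> P])
    define a where "a = y \<bullet> (par_sum \<Omega> Q *v y)"
    define b where "b = y \<bullet> (par_sum \<Omega> P *v y)"
    define w where "w = x \<bullet> (W *v x)"
    have w: "w > 0" using W x(2) by (simp add: w_def pos_def_def)
    have ab: "t * (b + w) \<le> a + w"
      using Vt[OF x(1)] by (simp add: mobius_form a_def b_def w_def y_def)
    have "y \<noteq> 0"
    proof
      assume "y = 0"
      then have "t * w \<le> w" using ab by (simp add: a_def b_def)
      then show False using t w by simp
    qed
    then have b: "b > 0" using pos_def_par_sum[OF \<Omega> P] by (simp add: b_def pos_def_def)
    have a: "a \<ge> 0" using pos_def_nonneg[OF pos_def_par_sum[OF \<Omega> Q]] by (simp add: a_def)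
    have "a \<le> y \<bullet> (matrix_inv \<Omega> *v y)"
      \<comment> \<open>The trivial splitting \<open>y = 0 + y\<close> bounds the parallel sum uniformly in \<open>Q\<close>.\<close>
      using par_sum_le[OF \<Omega> Q, of 0 y] by (simp add: a_def)
    then have "\<delta> * a \<le> \<delta> * (y \<bullet> (matrix_inv \<Omega> *v y))" using \<delta>(1) by simp
    also have "\<dots> \<le> w" using \<delta>(2)[of x] by (simp add: y_def w_def)
    finally have "(t - 1) * (\<delta> * a) \<le> (t - 1) * w" using t by simp
    then have "t * b + (t - 1) * (\<delta> * a) \<le> a" using ab by (simp add: algebra_simps)
    then have abt: "t powr (1 + \<delta>) * b \<le> a"
      using powr_one_plus_bound a b t \<delta>(1) by blast
    define r where "r = v \<bullet> (matrix_inv \<Omega> *v v)"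
    have r: "r \<ge> 0" using pos_def_nonneg[OF pos_def_matrix_inv[OF \<Omega>]] by (simp add: r_def)
    have bz: "b = (Z *v x) \<bullet> (P *v (Z *v x)) + r"
      unfolding b_def Z r_def v_def by (rule par_sum_form[OF \<Omega> P])
    have az: "a \<le> (Z *v x) \<bullet> (Q *v (Z *v x)) + r"
      using par_sum_le[OF \<Omega> Q, of "Z *v x" v] by (simp add: a_def y[symmetric] r_def)
    have "1 \<le> t powr (1 + \<delta>)" using t \<delta>(1) by (simp add: ge_one_powr_ge_zero)
    from mult_right_mono[OF this r] have "r \<le> t powr (1 + \<delta>) * r" by simp
    then have "t powr (1 + \<delta>) * ((Z *v x) \<bullet> (P *v (Z *v x))) \<le> (Z *v x) \<bullet> (Q *v (Z *v x))"
      using abt az unfolding bz distrib_left by linarith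
    moreover have "Z *v x \<noteq> 0"
    proof
      assume "Z *v x = 0"
      then have "par_sum \<Omega> P *v y = 0" using inv(1) unfolding Z invertible_iff_ker by blast
      then show False using inv(2) \<open>y \<noteq> 0\<close> unfolding invertible_iff_ker by blast
    qed
    ultimately show ?thesis by simp
  qed
  have lin: "linear ((*v) Z)" by (rule matrix_vector_mul_linear)
  have "inj_on ((*v) Z) (span V)"
    unfolding span_eq_iff[THEN iffD2, OF V(1)] linear_inj_on_iff_eq_0[OF lin V(1)]
    using key by blast
  then have "dim V = dim ((*v) Z ` V)" by (rule dim_image_eq[OF lin, symmetric])
  also have "\<dots> \<le> num_eigvals_ge P Q (t powr (1 + \<delta>))"
  proof (rule dim_le_num_eigvals_ge[OF P sym(2)])
    show "subspace ((*v) Z ` V)" by (rule linear_subspace_image[OF lin V(1)])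
    fix z assume "z \<in> (*v) Z ` V"
    then obtain x where x: "z = Z *v x" "x \<in> V" by auto
    then show "t powr (1 + \<delta>) * (z \<bullet> (P *v z)) \<le> z \<bullet> (Q *v z)"
      using key[of x] by (cases "x = 0") auto
  qed
  finally show ?thesis by (simp add: V(2))
qed

lemma mobius_strictly_contractive:
  fixes \<Omega> W \<alpha> :: "real^'n^'n"
  assumes \<Omega>: "pos_def \<Omega>" and W: "pos_def W"
  shows "strictly_contractive (mobius \<alpha> \<Omega> W)"
proof -
  obtain \<beta> where \<beta>: "\<beta> > 0"
    "\<And>x. x \<bullet> ((\<alpha> ** matrix_inv \<Omega> ** transpose \<alpha>) *v x) \<le> \<beta> * (x \<bullet> (W *v x))"
    using pos_def_dominates[OF W] by blast
  define \<delta> where "\<delta> = 1 / \<beta>"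
  have \<delta>: "\<delta> > 0" using \<beta>(1) by (simp add: \<delta>_def)
  have bound: "\<delta> * ((transpose \<alpha> *v x) \<bullet> (matrix_inv \<Omega> *v (transpose \<alpha> *v x))) \<le> x \<bullet> (W *v x)" for x
    using \<beta>(2)[of x] \<beta>(1) dot_matrix_vector[of x \<alpha>]
    by (simp add: \<delta>_def field_simps matrix_vector_mul_assoc[symmetric])
  show ?thesis
    unfolding strictly_contractive_def
  proof (intro conjI allI impI exI[of _ "1 / (1 + \<delta>)"])
    show "pos_def (mobius \<alpha> \<Omega> W P)" if "pos_def P" for P
      using mobius_pos_def[OF \<Omega> W that] .
    show "0 \<le> 1 / (1 + \<delta>)" "1 / (1 + \<delta>) < 1" using \<delta> by auto
    fix P Q :: "real^'n^'n" assume P: "pos_def P" and Q: "pos_def Q"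
    show "riemann_dist (mobius \<alpha> \<Omega> W P) (mobius \<alpha> \<Omega> W Q) \<le> 1 / (1 + \<delta>) * riemann_dist P Q"
      using \<delta> mobius_num_eigvals[OF \<Omega> W P Q \<delta> bound] mobius_num_eigvals[OF \<Omega> W Q P \<delta> bound]
      by (intro riemann_dist_contract P Q mobius_pos_def[OF \<Omega> W]) auto
  qed
qed

section \<open>The fixed point\<close>

lemma tendsto_matrix_mult:
  fixes X :: "nat \<Rightarrow> real^'n^'m" and Y :: "nat \<Rightarrow> real^'k^'n"
  assumes "X \<longlonglongrightarrow> L" "Y \<longlonglongrightarrow> M"
  shows "(\<lambda>k. X k ** Y k) \<longlonglongrightarrow> L ** M"
proof (intro vec_tendstoI)
  fix i j
  show "(\<lambda>k. (X k ** Y k) $ i $ j) \<longlonglongrightarrow> (L ** M) $ i $ j"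
    unfolding matrix_matrix_mult_def vec_lambda_beta
    by (intro tendsto_sum tendsto_mult tendsto_vec_nth assms)
qed

lemma tendsto_form:
  fixes X :: "nat \<Rightarrow> real^'n^'n"
  assumes "X \<longlonglongrightarrow> L"
  shows "(\<lambda>k. x \<bullet> (X k *v y)) \<longlonglongrightarrow> x \<bullet> (L *v y)"
  unfolding inner_vec_def matrix_vector_mult_def vec_lambda_beta inner_real_def
  by (intro tendsto_sum tendsto_mult tendsto_vec_nth tendsto_const assms)

text \<open>Monotone bounded forms converge pointwise, and by polarization the entries of the matrices are
  combinations of their values.\<close>

lemma loewner_convergent:
  fixes X :: "nat \<Rightarrow> real^'n^'n"
  assumes sym: "\<And>k. transpose (X k) = X k"
    and inc: "\<And>k x. x \<bullet> (X k *v x) \<le> x \<bullet> (X (Suc k) *v x)"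
    and bound: "\<And>k x. x \<bullet> (X k *v x) \<le> x \<bullet> (G *v x)"
  shows "convergent X"
proof -
  have "convergent (\<lambda>k. x \<bullet> (X k *v x))" for x
  proof -
    have "incseq (\<lambda>k. x \<bullet> (X k *v x))" using inc by (simp add: incseq_SucI)
    then obtain l where "(\<lambda>k. x \<bullet> (X k *v x)) \<longlonglongrightarrow> l"
      using incseq_convergent[of "\<lambda>k. x \<bullet> (X k *v x)" "x \<bullet> (G *v x)"] bound by blast
    then show ?thesis by (auto simp: convergent_def)
  qed
  then obtain f where f: "(\<lambda>k. x \<bullet> (X k *v x)) \<longlonglongrightarrow> f x" for x
    unfolding convergent_def by metis
  define e :: "'n \<Rightarrow> real^'n" where "e i = axis i 1" for i
  have entry: "X k $ i $ j = ((e i + e j) \<bullet> (X k *v (e i + e j)) - e i \<bullet> (X k *v e i) - e j \<bullet> (X k *v e j)) / 2"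
    for k i j
  proof -
    have "X k $ i $ j = e i \<bullet> (X k *v e j)"
      by (simp add: e_def inner_axis' matrix_vector_mult_basis column_def)
    then show ?thesis
      using form_sym[OF sym, of "e i" k "e j"]
      by (simp add: matrix_vector_right_distrib inner_add_left inner_add_right)
  qed
  have "X \<longlonglongrightarrow> (\<chi> i j. (f (e i + e j) - f (e i) - f (e j)) / 2)"
  proof (intro vec_tendstoI)
    fix i j
    show "(\<lambda>k. X k $ i $ j) \<longlonglongrightarrow> (\<chi> i j. (f (e i + e j) - f (e i) - f (e j)) / 2) $ i $ j"
      unfolding entry vec_lambda_beta by (intro tendsto_divide tendsto_diff tendsto_const f) simp
  qed
  then show ?thesis by (auto simp: convergent_def)
qed

text \<open>A minimum over splittings is monotone in the form that is minimized: the optimal splitting for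
  \<open>Q\<close> is a competitor for \<open>P\<close>.\<close>

lemma par_sum_mono:
  assumes \<Omega>: "pos_def \<Omega>" and P: "pos_def P" and Q: "pos_def Q"
    and le: "\<And>x. x \<bullet> (P *v x) \<le> x \<bullet> (Q *v x)"
  shows "y \<bullet> (par_sum \<Omega> P *v y) \<le> y \<bullet> (par_sum \<Omega> Q *v y)"
proof -
  define z where "z = matrix_inv Q *v (par_sum \<Omega> Q *v y)"
  define v where "v = \<Omega> *v (par_sum \<Omega> Q *v y)"
  have y: "y = z + v" using par_sum_split[OF \<Omega> Q] by (simp add: z_def v_def)
  have "y \<bullet> (par_sum \<Omega> P *v y) \<le> z \<bullet> (P *v z) + v \<bullet> (matrix_inv \<Omega> *v v)"
    unfolding y by (rule par_sum_le[OF \<Omega> P])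
  also have "\<dots> \<le> z \<bullet> (Q *v z) + v \<bullet> (matrix_inv \<Omega> *v v)" using le by simp
  also have "\<dots> = y \<bullet> (par_sum \<Omega> Q *v y)" unfolding z_def v_def by (rule par_sum_form[OF \<Omega> Q, symmetric])
  finally show ?thesis .
qed

lemma matrix_mul_add_left:
  fixes X Y :: "real^'n^'m"
  shows "(X + Y) ** Z = X ** Z + Y ** Z"
  by (simp add: matrix_matrix_mult_def vec_eq_iff sum.distrib algebra_simps)

text \<open>The equation \<open>Y + L \<Omega> Y = L\<close> is free of inverses; in this form the definition of the parallel sum
  passes to limits.\<close>

lemma par_sum_eqI:
  assumes "invertible L" "Y + L ** \<Omega> ** Y = L"
  shows "par_sum \<Omega> L = Y"
  unfolding par_sum_def
proof (rule matrix_inv_unique)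
  have "(matrix_inv L + \<Omega>) ** Y = matrix_inv L ** (Y + L ** \<Omega> ** Y)"
    by (simp add: matrix_add_ldistrib matrix_mul_add_left matrix_mul_assoc matrix_inv_right_left[OF assms(1)])
  then show "(matrix_inv L + \<Omega>) ** Y = mat 1"
    by (simp add: assms matrix_inv_right_left)
qed

text \<open>The iterates of \<open>W\<close> increase because \<open>W \<le> f(P)\<close> for all \<open>P\<close> and \<open>f\<close> is monotone, and the parallel
  sums stay below \<open>\<Omega>\<^sup>-\<^sup>1\<close>.\<close>

lemma mobius_fixed_point:
  fixes \<Omega> W \<alpha> :: "real^'n^'n"
  assumes \<Omega>: "pos_def \<Omega>" and W: "pos_def W"
  shows "\<exists>P. pos_def P \<and> mobius \<alpha> \<Omega> W P = P"
proof -
  define X where "X k = (mobius \<alpha> \<Omega> W ^^ k) W" for k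
  define Y where "Y k = par_sum \<Omega> (X k)" for k
  have X0: "X 0 = W" and XS: "X (Suc k) = mobius \<alpha> \<Omega> W (X k)" for k by (simp_all add: X_def)
  have Xpd: "pos_def (X k)" for k
    by (induction k) (auto simp: X0 XS W mobius_pos_def[OF \<Omega> W])
  have Ypd: "pos_def (Y k)" for k by (simp add: Y_def pos_def_par_sum[OF \<Omega> Xpd])
  have Xinc: "x \<bullet> (X k *v x) \<le> x \<bullet> (X (Suc k) *v x)" for k x
  proof (induction k arbitrary: x)
    case 0
    show ?case
      using pos_def_nonneg[OF pos_def_par_sum[OF \<Omega> W]] by (simp add: X0 XS mobius_form)
  next
    case (Suc k)
    have "y \<bullet> (par_sum \<Omega> (X k) *v y) \<le> y \<bullet> (par_sum \<Omega> (X (Suc k)) *v y)" for y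
      using par_sum_mono[OF \<Omega> Xpd Xpd Suc.IH] .
    then show ?case unfolding XS[of k] XS[of "Suc k"] mobius_form by (simp add: XS)
  qed
  have "convergent Y"
  proof (rule loewner_convergent)
    show "transpose (Y k) = Y k" for k using Ypd by (simp add: pos_def_def)
    show "y \<bullet> (Y k *v y) \<le> y \<bullet> (Y (Suc k) *v y)" for k y
      unfolding Y_def by (rule par_sum_mono[OF \<Omega> Xpd Xpd Xinc])
    show "y \<bullet> (Y k *v y) \<le> y \<bullet> (matrix_inv \<Omega> *v y)" for k y
      using par_sum_le[OF \<Omega> Xpd, of 0 y k] by (simp add: Y_def)
  qed
  then obtain Z where Z: "Y \<longlonglongrightarrow> Z" by (auto simp: convergent_def)
  define L where "L = \<alpha> ** Z ** transpose \<alpha> + W"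
  have "(\<lambda>k. X (Suc k)) \<longlonglongrightarrow> L"
    unfolding XS mobius_def L_def Y_def[symmetric]
    by (intro tendsto_add tendsto_matrix_mult tendsto_const Z)
  then have X: "X \<longlonglongrightarrow> L" by (rule LIMSEQ_imp_Suc)
  have L: "pos_def L"
    unfolding pos_def_def
  proof (intro conjI allI impI)
    have lim: "(\<lambda>k. X k $ i $ j) \<longlonglongrightarrow> L $ i $ j" for i j by (intro tendsto_vec_nth X)
    have "X k $ i $ j = X k $ j $ i" for i j k
      using Xpd[of k] by (simp add: pos_def_def transpose_def vec_eq_iff)
    then have "L $ i $ j = L $ j $ i" for i j
      using LIMSEQ_unique[OF lim[of i j]] lim[of j i] by simp
    then show "transpose L = L" by (simp add: transpose_def vec_eq_iff)
    fix x :: "real^'n" assume "x \<noteq> 0"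
    then have "0 < x \<bullet> (W *v x)" using W by (simp add: pos_def_def)
    also have "x \<bullet> (W *v x) \<le> x \<bullet> (L *v x)"
    proof (rule LIMSEQ_le_const[OF tendsto_form[OF X]])
      have "x \<bullet> (W *v x) \<le> x \<bullet> (X k *v x)" for k
      proof (induction k)
        case (Suc k)
        then show ?case using Xinc[of x k] by linarith
      qed (simp add: X0)
      then show "\<exists>N. \<forall>k\<ge>N. x \<bullet> (W *v x) \<le> x \<bullet> (X k *v x)" by blast
    qed
    finally show "0 < x \<bullet> (L *v x)" .
  qed
  have XY: "Y k + X k ** \<Omega> ** Y k = X k" for k
  proof -
    have "(matrix_inv (X k) + \<Omega>) ** Y k = mat 1"
      unfolding Y_def par_sum_def
      by (intro matrix_inv_right_left pos_def_invertible pos_def_add pos_def_matrix_inv Xpd \<Omega>)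
    then have "X k ** ((matrix_inv (X k) + \<Omega>) ** Y k) = X k" by simp
    then show ?thesis
      by (simp add: matrix_add_ldistrib matrix_mul_add_left matrix_mul_assoc
          matrix_inv_right_left pos_def_invertible[OF Xpd])
  qed
  have "(\<lambda>k. Y k + X k ** \<Omega> ** Y k) \<longlonglongrightarrow> Z + L ** \<Omega> ** Z"
    by (intro tendsto_add tendsto_matrix_mult tendsto_const X Z)
  then have "Z + L ** \<Omega> ** Z = L"
    unfolding XY using X LIMSEQ_unique by blast
  then have "par_sum \<Omega> L = Z" by (rule par_sum_eqI[OF pos_def_invertible[OF L]])
  then have "mobius \<alpha> \<Omega> W L = L" by (simp add: mobius_def L_def)
  with L show ?thesis by blast
qed

lemma mobius_unique_fixed_point:
  fixes \<Omega> W \<alpha> :: "real^'n^'n"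
  assumes \<Omega>: "pos_def \<Omega>" and W: "pos_def W"
  shows "\<exists>!P. pos_def P \<and> mobius \<alpha> \<Omega> W P = P"
proof -
  obtain c where c: "c < 1"
    "\<And>P Q. pos_def P \<Longrightarrow> pos_def Q \<Longrightarrow> riemann_dist (mobius \<alpha> \<Omega> W P) (mobius \<alpha> \<Omega> W Q) \<le> c * riemann_dist P Q"
    using mobius_strictly_contractive[OF \<Omega> W, of \<alpha>] unfolding strictly_contractive_def by blast
  have "P = Q" if "pos_def P" "mobius \<alpha> \<Omega> W P = P" "pos_def Q" "mobius \<alpha> \<Omega> W Q = Q" for P Q
  proof (rule riemann_dist_eq_0)
    have "0 \<le> riemann_dist P Q"
      using that by (simp add: riemann_dist_pos_log_sum pos_log_sum_nonneg)
    moreover have "(1 - c) * riemann_dist P Q \<le> 0"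
      using c(2)[of P Q] that by (simp add: left_diff_distrib)
    ultimately show "riemann_dist P Q = 0"
      using c(1) by (simp add: mult_le_0_iff)
  qed (use that in auto)
  then show ?thesis using mobius_fixed_point[OF \<Omega> W, of \<alpha>] by blast
qed

section \<open>Eliminating the inputs\<close>

text \<open>The product of two stacked matrices with respect to the indefinite form \<open>diag(I, - \<theta> I)\<close>. All
  coefficients of the block map are built from it without inverting this form, so that \<open>\<theta> = 0\<close> is not an
  exceptional case.\<close>

definition indef_gram :: "real \<Rightarrow> real^'a^'c \<Rightarrow> real^'a^'d \<Rightarrow> real^'b^'c \<Rightarrow> real^'b^'d \<Rightarrow> real^'b^'a" where
  "indef_gram \<theta> X X' Y Y' = transpose X ** Y - \<theta> *\<^sub>R (transpose X' ** Y')"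

lemma indef_gram_vec:
  "indef_gram \<theta> X X' Y Y' *v y = transpose X *v (Y *v y) - \<theta> *\<^sub>R (transpose X' *v (Y' *v y))"
  by (simp add: indef_gram_def matrix_vector_mult_diff_rdistrib matrix_vector_mul_assoc scaleR_matrix_vector_assoc)

lemma indef_gram_transpose: "transpose (indef_gram \<theta> X X' Y Y') = indef_gram \<theta> Y Y' X X'"
  by (simp add: transpose_add transpose_diff indef_gram_def matrix_transpose_mul transpose_scalar)

lemma indef_gram_inner:
  "x \<bullet> (indef_gram \<theta> X X' Y Y' *v y) = (X *v x) \<bullet> (Y *v y) - \<theta> * ((X' *v x) \<bullet> (Y' *v y))"
  by (simp add: indef_gram_vec inner_diff_right dot_matrix_vector)

section \<open>Elimination\<close>

text \<open>\<open>block_form\<close> is a quadratic form in \<open>(x,u)\<close>. Its \<open>u\<close>-block is \<open>elim_mat\<close>, and \<open>schur_mat\<close> is the Schur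
  complement of that block.\<close>

definition elim_mat :: "real \<Rightarrow> real^'u^'c \<Rightarrow> real^'u^'d \<Rightarrow> real^'u^'u" where
  "elim_mat \<theta> H L = mat 1 + indef_gram \<theta> H L H L"

definition schur_mat :: "real \<Rightarrow> real^'u^'c \<Rightarrow> real^'u^'d \<Rightarrow> real^'n^'c \<Rightarrow> real^'n^'d \<Rightarrow> real^'n^'n" where
  "schur_mat \<theta> H L X Y = indef_gram \<theta> X Y X Y
     - indef_gram \<theta> X Y H L ** matrix_inv (elim_mat \<theta> H L) ** indef_gram \<theta> H L X Y"

definition block_form :: "real \<Rightarrow> real^'u^'c \<Rightarrow> real^'u^'d \<Rightarrow> real^'n^'c \<Rightarrow> real^'n^'d \<Rightarrow> real^'n \<Rightarrow> real^'u \<Rightarrow> real" where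
  "block_form \<theta> H L X Y x u = u \<bullet> u + (X *v x + H *v u) \<bullet> (X *v x + H *v u)
     - \<theta> * ((Y *v x + L *v u) \<bullet> (Y *v x + L *v u))"

lemma elim_mat_sym: "transpose (elim_mat \<theta> H L) = elim_mat \<theta> H L"
  by (simp add: transpose_add transpose_diff elim_mat_def indef_gram_transpose)

lemma elim_mat_form: "u \<bullet> (elim_mat \<theta> H L *v u) = block_form \<theta> H L X Y 0 u"
  by (simp add: elim_mat_def block_form_def matrix_vector_mult_add_rdistrib inner_add_right indef_gram_inner)

lemma schur_mat_sym:
  assumes "invertible (elim_mat \<theta> H L)"
  shows "transpose (schur_mat \<theta> H L X Y) = schur_mat \<theta> H L X Y"
  by (simp add: transpose_add transpose_diff schur_mat_def matrix_transpose_mul indef_gram_transpose matrix_mul_assoc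
        transpose_matrix_inv[OF assms elim_mat_sym])

lemma schur_mat_vec:
  "schur_mat \<theta> H L X Y *v x = indef_gram \<theta> X Y X Y *v x
     - indef_gram \<theta> X Y H L *v (matrix_inv (elim_mat \<theta> H L) *v (indef_gram \<theta> H L X Y *v x))"
  by (simp add: schur_mat_def matrix_vector_mult_diff_rdistrib matrix_vector_mul_assoc matrix_mul_assoc)

lemma block_form_complete_square:
  fixes H :: "real^'u^'c" and L :: "real^'u^'d" and X :: "real^'n^'c" and Y :: "real^'n^'d"
  assumes inv: "invertible (elim_mat \<theta> H L)"
  defines "m \<equiv> \<lambda>x. matrix_inv (elim_mat \<theta> H L) *v (indef_gram \<theta> H L X Y *v x)"
  shows "block_form \<theta> H L X Y x u =
    x \<bullet> (schur_mat \<theta> H L X Y *v x) + (u + m x) \<bullet> (elim_mat \<theta> H L *v (u + m x))"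
proof -
  let ?M = "elim_mat \<theta> H L"
  define g where "g = indef_gram \<theta> H L X Y *v x"
  have Mm: "?M *v m x = g" by (simp add: m_def g_def matrix_inv_cancel[OF inv])
  have "block_form \<theta> H L X Y x u = u \<bullet> (?M *v u) + 2 * (u \<bullet> g) + x \<bullet> (indef_gram \<theta> X Y X Y *v x)"
    by (simp add: block_form_def elim_mat_def g_def matrix_vector_mult_add_rdistrib inner_add_right
        inner_add_left indef_gram_inner inner_commute algebra_simps)
  moreover have "(u + m x) \<bullet> (?M *v (u + m x)) = u \<bullet> (?M *v u) + 2 * (u \<bullet> g) + m x \<bullet> g"
    using form_sym[OF elim_mat_sym[of \<theta> H L], of "m x" u]
    by (simp add: matrix_vector_right_distrib inner_add_left inner_add_right Mm)
  moreover have "x \<bullet> (schur_mat \<theta> H L X Y *v x) = x \<bullet> (indef_gram \<theta> X Y X Y *v x) - m x \<bullet> g"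
    using dot_matrix_vector[of x "indef_gram \<theta> X Y H L" "m x"]
    by (simp add: schur_mat_vec m_def inner_diff_right indef_gram_transpose g_def inner_commute)
  ultimately show ?thesis by simp
qed

lemma schur_mat_le_block_form:
  assumes M: "pos_def (elim_mat \<theta> H L)"
  shows "x \<bullet> (schur_mat \<theta> H L X Y *v x) \<le> block_form \<theta> H L X Y x u"
  using block_form_complete_square[OF pos_def_invertible[OF M], of X Y x u] pos_def_nonneg[OF M] by simp

lemma schur_mat_attains_block_form:
  assumes M: "pos_def (elim_mat \<theta> H L)"
  obtains u where "x \<bullet> (schur_mat \<theta> H L X Y *v x) = block_form \<theta> H L X Y x u"
proof (rule that)
  show "x \<bullet> (schur_mat \<theta> H L X Y *v x) =
      block_form \<theta> H L X Y x (- (matrix_inv (elim_mat \<theta> H L) *v (indef_gram \<theta> H L X Y *v x)))"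
    by (simp add: block_form_complete_square[OF pos_def_invertible[OF M]])
qed

text \<open>The form is affine in \<open>\<theta>\<close>, which makes its first degenerate parameter a Rayleigh quotient.\<close>

lemma block_form_alt:
  "block_form \<theta> H L X Y x u = block_form 0 H L X Y x u - \<theta> * ((Y *v x + L *v u) \<bullet> (Y *v x + L *v u))"
  by (simp add: block_form_def)

text \<open>Write the form as \<open>a - \<theta> b\<close> and let \<open>z\<close> maximize \<open>b / a\<close>. If \<open>\<theta> b(z) \<ge> a(z)\<close>, then
  \<open>\<eta> = a(z) / b(z) \<le> \<theta>\<close> and \<open>a - \<eta> b\<close> is nonnegative with null vector \<open>z\<close>, so the Schur complement at \<open>\<eta>\<close> is
  singular. Otherwise \<open>a - \<theta> b\<close> is positive definite, and so is its Schur complement.\<close>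

lemma schur_mat_pos_def_before_singular:
  fixes H :: "real^'u^'c" and L :: "real^'u^'d" and X :: "real^'n^'c" and Y :: "real^'n^'d"
  assumes M: "\<And>\<eta>. 0 \<le> \<eta> \<Longrightarrow> \<eta> \<le> \<theta> \<Longrightarrow> pos_def (elim_mat \<eta> H L)"
    and inv: "\<And>\<eta>. 0 \<le> \<eta> \<Longrightarrow> \<eta> \<le> \<theta> \<Longrightarrow> invertible (schur_mat \<eta> H L X Y)"
    and X: "\<And>x. X *v x = 0 \<Longrightarrow> x = 0" and \<theta>: "0 \<le> \<theta>"
  shows "pos_def (schur_mat \<theta> H L X Y)"
proof -
  define a where "a z = block_form 0 H L X Y (fst z) (snd z)" for z :: "(real^'n) \<times> (real^'u)"
  define b where "b z = (Y *v fst z + L *v snd z) \<bullet> (Y *v fst z + L *v snd z)" for z :: "(real^'n) \<times> (real^'u)"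
  have form: "block_form \<eta> H L X Y (fst z) (snd z) = a z - \<eta> * b z" for \<eta> z
    unfolding a_def b_def by (rule block_form_alt)
  have apos: "a z > 0" if "z \<noteq> 0" for z
  proof (rule ccontr)
    assume "\<not> a z > 0"
    then have le: "snd z \<bullet> snd z + (X *v fst z + H *v snd z) \<bullet> (X *v fst z + H *v snd z) \<le> 0"
      by (simp add: a_def block_form_def)
    then have "snd z \<bullet> snd z = 0" "(X *v fst z + H *v snd z) \<bullet> (X *v fst z + H *v snd z) = 0"
      using inner_ge_zero[of "snd z"] inner_ge_zero[of "X *v fst z + H *v snd z"] by linarith+
    then have "snd z = 0" "fst z = 0" using X by auto
    then show False using that by (simp add: prod_eq_iff)
  qed
  have cont: "continuous_on UNIV (\<lambda>z :: (real^'n) \<times> (real^'u). A *v fst z)" for A :: "real^'n^'e"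
    by (intro bounded_linear.continuous_on[OF matrix_vector_mul_bounded_linear] continuous_intros)
  have cont': "continuous_on UNIV (\<lambda>z :: (real^'n) \<times> (real^'u). A *v snd z)" for A :: "real^'u^'e"
    by (intro bounded_linear.continuous_on[OF matrix_vector_mul_bounded_linear] continuous_intros)
  have ne: "(UNIV :: ((real^'n) \<times> (real^'u)) set) \<noteq> {0}"
  proof -
    have "(axis undefined 1, 0) \<noteq> (0 :: (real^'n) \<times> (real^'u))" by (simp add: axis_eq_0_iff prod_eq_iff)
    then show ?thesis by auto
  qed
  obtain z :: "(real^'n) \<times> (real^'u)" where z: "z \<noteq> 0" "\<And>y. b y * a z \<le> b z * a y"
  proof (rule rayleigh_max[OF subspace_UNIV ne, of a b])
    show "continuous_on UNIV a" "continuous_on UNIV b"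
      unfolding a_def b_def block_form_def by (intro continuous_intros cont cont')+
    show "a (c *\<^sub>R x) = c\<^sup>2 * a x" "b (c *\<^sub>R x) = c\<^sup>2 * b x" for c x
      by (simp_all add: a_def b_def block_form_def matrix_vector_mult_scaleR inner_add_left
          inner_add_right power2_eq_square algebra_simps)
  qed (use apos in auto)
  have b0: "0 \<le> b y" for y by (simp add: b_def)
  have az: "a z > 0" by (rule apos[OF z(1)])
  have "\<theta> * b z < a z"
  proof (rule ccontr)
    assume "\<not> \<theta> * b z < a z"
    then have le: "a z \<le> \<theta> * b z" by simp
    have bz: "b z > 0" using le az b0[of z] by (cases "b z = 0") auto
    define \<eta> where "\<eta> = a z / b z"
    have \<eta>: "0 < \<eta>" "\<eta> \<le> \<theta>" using az bz le by (auto simp: \<eta>_def field_simps)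
    have nonneg: "0 \<le> block_form \<eta> H L X Y (fst y) (snd y)" for y
      using z(2)[of y] bz by (simp add: form \<eta>_def field_simps)
    have null: "block_form \<eta> H L X Y (fst z) (snd z) = 0"
      using bz by (simp add: form \<eta>_def)
    have M\<eta>: "pos_def (elim_mat \<eta> H L)" and inv\<eta>: "invertible (schur_mat \<eta> H L X Y)"
      using M inv \<eta> by auto
    have psd: "0 \<le> x \<bullet> (schur_mat \<eta> H L X Y *v x)" for x
    proof -
      obtain u where "x \<bullet> (schur_mat \<eta> H L X Y *v x) = block_form \<eta> H L X Y x u"
        by (rule schur_mat_attains_block_form[OF M\<eta>])
      then show ?thesis using nonneg[of "(x, u)"] by simp
    qed
    have "fst z \<bullet> (schur_mat \<eta> H L X Y *v fst z) = 0"
      using schur_mat_le_block_form[OF M\<eta>, of "fst z" X Y "snd z"] null psd[of "fst z"] by simp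
    then have "h \<bullet> (schur_mat \<eta> H L X Y *v fst z) = 0" for h
      using psd_null_vector[OF schur_mat_sym[OF pos_def_invertible[OF M\<eta>]] subspace_UNIV, of X Y "fst z" h]
        psd by auto
    then have "schur_mat \<eta> H L X Y *v fst z = 0" by (metis inner_eq_zero_iff)
    then have f0: "fst z = 0" using inv\<eta> unfolding invertible_iff_ker by blast
    then have "snd z \<noteq> 0" using z(1) by (simp add: prod_eq_iff)
    then have "0 < snd z \<bullet> (elim_mat \<eta> H L *v snd z)" using M\<eta> by (simp add: pos_def_def)
    then show False using null f0 elim_mat_form[of "snd z" \<eta> H L X Y] by simp
  qed
  have pos: "0 < block_form \<theta> H L X Y (fst y) (snd y)" if "y \<noteq> 0" for y
  proof -
    have "\<theta> * (b y * a z) \<le> \<theta> * (b z * a y)" using z(2)[of y] \<theta> by (rule mult_left_mono)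
    also have "\<dots> < a z * a y" using \<open>\<theta> * b z < a z\<close> apos[OF that] by simp
    finally have "(\<theta> * b y) * a z < a y * a z" by (simp add: ac_simps)
    then have "\<theta> * b y < a y" using az by (simp add: mult_less_cancel_right)
    then show ?thesis by (simp add: form)
  qed
  have M\<theta>: "pos_def (elim_mat \<theta> H L)" using M \<theta> by auto
  show ?thesis
    unfolding pos_def_def
  proof (intro conjI allI impI)
    show "transpose (schur_mat \<theta> H L X Y) = schur_mat \<theta> H L X Y"
      by (rule schur_mat_sym[OF pos_def_invertible[OF M\<theta>]])
    fix x :: "real^'n" assume x: "x \<noteq> 0"
    obtain u where "x \<bullet> (schur_mat \<theta> H L X Y *v x) = block_form \<theta> H L X Y x u"
      by (rule schur_mat_attains_block_form[OF M\<theta>])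
    then show "0 < x \<bullet> (schur_mat \<theta> H L X Y *v x)" using pos[of "(x, u)"] x by (simp add: prod_eq_iff)
  qed
qed

section \<open>Largest eigenvalue\<close>

section \<open>The bound on the risk parameter\<close>

lemma pos_def_one: "pos_def (mat 1)"
  by (simp add: pos_def_def)

lemma form_le_lambda1:
  fixes X :: "real^'n^'n"
  assumes "transpose X = X"
  shows "x \<bullet> (X *v x) \<le> lambda1 X * (x \<bullet> x)"
proof -
  obtain T :: "real^'n^'n" and s where T: "invertible T" "transpose T ** mat 1 ** T = mat 1" "X ** T = mat 1 ** T ** diag s"
    using pencil_diagonalization[OF pos_def_one assms] by blast
  have e: "eigvals X = image_mset s (mset_set UNIV)"
    using eigvals_diagonalizable[OF T(1)] T(3) by simp
  have s: "s i \<le> lambda1 X" for i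
    by (simp add: lambda1_def e)
  obtain y where y: "x = T *v y" using matrix_inv_cancel(1)[OF T(1)] by metis
  have "x \<bullet> (X *v x) = (\<Sum>i\<in>UNIV. s i * (y $ i)\<^sup>2)"
    unfolding y by (rule pencil_forms(2)[OF T(2,3)])
  also have "\<dots> \<le> (\<Sum>i\<in>UNIV. lambda1 X * (y $ i)\<^sup>2)" by (intro sum_mono mult_right_mono s) simp
  also have "\<dots> = lambda1 X * (x \<bullet> x)"
    using pencil_forms(1)[OF T(2,3), of y] by (simp add: y sum_distrib_left)
  finally show ?thesis .
qed

text \<open>With \<open>E = I + H\<^sup>T H\<close>, \<open>K = L E\<^sup>-\<^sup>1 L\<^sup>T\<close>, \<open>w = L u\<close> and \<open>l\<close> the largest eigenvalue of \<open>K\<close>, a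
  Cauchy--Schwarz argument gives \<open>|w|\<^sup>2 \<le> l u\<^sup>T E u\<close>, hence \<open>\<theta> |L u|\<^sup>2 < u\<^sup>T E u\<close> when \<open>\<theta> l < 1\<close>. It takes the form of
  Young's inequality for \<open>l u\<close> and \<open>L\<^sup>T w\<close>.\<close>

lemma elim_mat_pos_def:
  fixes H :: "real^'u^'c" and L :: "real^'u^'d"
  assumes \<theta>: "0 \<le> \<theta>"
    and lt: "L = 0 \<or> \<theta> < 1 / lambda1 (L ** matrix_inv (mat 1 + transpose H ** H) ** transpose L)"
  shows "pos_def (elim_mat \<theta> H L)"
  unfolding pos_def_def
proof (intro conjI allI impI)
  show "transpose (elim_mat \<theta> H L) = elim_mat \<theta> H L" by (rule elim_mat_sym)
  fix u :: "real^'u" assume u: "u \<noteq> 0"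
  define E where "E = mat 1 + transpose H ** H"
  have E: "u \<bullet> (E *v u) = u \<bullet> u + (H *v u) \<bullet> (H *v u)" for u
    by (simp add: E_def matrix_vector_mult_add_rdistrib inner_add_right
        matrix_vector_mul_assoc[symmetric] dot_matrix_vector)
  have Epd: "pos_def E"
    unfolding pos_def_def E
  proof (intro conjI allI impI)
    show "transpose E = E" by (simp add: E_def matrix_transpose_mul transpose_add)
  qed (simp add: add_pos_nonneg)
  have form: "u \<bullet> (elim_mat \<theta> H L *v u) = u \<bullet> (E *v u) - \<theta> * ((L *v u) \<bullet> (L *v u))"
    by (simp add: elim_mat_def matrix_vector_mult_add_rdistrib inner_add_right indef_gram_inner E)
  have Epos: "0 < u \<bullet> (E *v u)" using Epd u by (simp add: pos_def_def)
  show "0 < u \<bullet> (elim_mat \<theta> H L *v u)"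
  proof (cases "L = 0")
    case True
    then show ?thesis unfolding form using Epos by simp
  next
    case False
    define K where "K = L ** matrix_inv E ** transpose L"
    define l where "l = lambda1 K"
    have "\<theta> < 1 / l" using lt False by (simp add: l_def K_def E_def)
    then have l: "l > 0" using \<theta> by (metis divide_nonneg_nonpos le_less_trans less_irrefl not_less zero_le_one)
    have \<theta>l: "\<theta> * l < 1" using \<open>\<theta> < 1 / l\<close> l by (simp add: field_simps)
    define w where "w = L *v u"
    have symK: "transpose K = K"
      using pos_def_matrix_inv[OF Epd] by (simp add: K_def matrix_transpose_mul matrix_mul_assoc pos_def_def)
    have "2 * ((l *\<^sub>R u) \<bullet> (transpose L *v w)) \<le> (l *\<^sub>R u) \<bullet> (E *v (l *\<^sub>R u))
        + (transpose L *v w) \<bullet> (matrix_inv E *v (transpose L *v w))"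
      by (rule young_form[OF Epd])
    also have "(transpose L *v w) \<bullet> (matrix_inv E *v (transpose L *v w)) = w \<bullet> (K *v w)"
      by (simp add: K_def matrix_vector_mul_assoc[symmetric] dot_matrix_vector)
    also have "w \<bullet> (K *v w) \<le> l * (w \<bullet> w)" unfolding l_def by (rule form_le_lambda1[OF symK])
    also have "(l *\<^sub>R u) \<bullet> (transpose L *v w) = l * (w \<bullet> w)"
      by (simp add: w_def dot_matrix_vector[of u "transpose L"])
    finally have "l * (w \<bullet> w) \<le> l * (l * (u \<bullet> (E *v u)))"
      by (simp add: matrix_vector_mult_scaleR)
    then have "w \<bullet> w \<le> l * (u \<bullet> (E *v u))" using l by simp
    then have "\<theta> * (w \<bullet> w) \<le> (\<theta> * l) * (u \<bullet> (E *v u))" using mult_left_mono[OF _ \<theta>] by (simp add: mult.assoc)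
    also have "\<dots> < 1 * (u \<bullet> (E *v u))" using \<theta>l Epos by (rule mult_strict_right_mono)
    finally show ?thesis by (simp add: form w_def)
  qed
qed

section \<open>Stacked blocks\<close>

section \<open>Closed forms of the block coefficients\<close>

definition stack_vec :: "real^'a \<Rightarrow> real^'b \<Rightarrow> real^('a + 'b)" where
  "stack_vec a b = (\<chi> i. case i of Inl i \<Rightarrow> a $ i | Inr j \<Rightarrow> b $ j)"

lemma stack_vec_nth [simp]: "stack_vec a b $ Inl i = a $ i" "stack_vec a b $ Inr j = b $ j"
  by (simp_all add: stack_vec_def)

lemma stack_vec_cases: obtains a b where "v = stack_vec a b"
proof (rule that)
  show "v = stack_vec (\<chi> i. v $ Inl i) (\<chi> j. v $ Inr j)"
    by (simp add: vec_eq_iff stack_vec_def split: sum.split)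
qed

lemma vec_sum_eq_iff:
  "(v :: real^('a::finite + 'b::finite)) = w \<longleftrightarrow> (\<forall>i. v $ Inl i = w $ Inl i) \<and> (\<forall>j. v $ Inr j = w $ Inr j)"
  unfolding vec_eq_iff by (metis sum.exhaust)

lemma sum_UNIV_plus: "(\<Sum>i\<in>UNIV. f i) = (\<Sum>a\<in>UNIV. f (Inl a)) + (\<Sum>b\<in>UNIV. f (Inr (b :: 'b::finite) :: 'a::finite + 'b) :: real)"
  using sum.Plus[of "UNIV :: 'a set" "UNIV :: 'b set" f] by (simp add: comp_def)

lemma stack_vec_add: "stack_vec a b + stack_vec c d = stack_vec (a + c) (b + d)"
  by (simp add: vec_sum_eq_iff)

lemma stack_vec_diff: "stack_vec a b - stack_vec c d = stack_vec (a - c) (b - d)"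
  by (simp add: vec_sum_eq_iff)

lemma vstack_vec: "vstack X Y *v x = stack_vec (X *v x) (Y *v x)"
  by (simp add: vec_sum_eq_iff matrix_vector_mult_def vstack_def)

lemma vstack_transpose_vec:
  "transpose (vstack X Y) *v stack_vec a b = transpose X *v a + transpose Y *v b"
  by (simp add: vec_eq_iff matrix_vector_mult_def vstack_def transpose_def sum_UNIV_plus)

lemma bdiag_vec: "bdiag X Y *v stack_vec a b = stack_vec (X *v a) (Y *v b)"
  by (simp add: vec_sum_eq_iff matrix_vector_mult_def bdiag_def sum_UNIV_plus)

lemma matrix_eqI_stack:
  fixes X Y :: "real^('a::finite + 'b::finite)^'c"
  assumes "\<And>a b. X *v stack_vec a b = Y *v stack_vec a b"
  shows "X = Y"
  unfolding matrix_eq using assms by (metis stack_vec_cases)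

lemma scaleR_mat_one_vec: "(c *\<^sub>R mat 1) *v (x :: real^'n) = c *\<^sub>R x"
  by (simp add: scaleR_matrix_vector_assoc[symmetric])

lemma minus_matrix_vec: "(- M) *v x = - (M *v (x :: real^'n))"
  by (simp add: matrix_vector_mult_def vec_eq_iff sum_negf)

text \<open>The Woodbury identity \<open>(J\<^sup>-\<^sup>1 + F F\<^sup>T)\<^sup>-\<^sup>1 = J - J F M\<^sup>-\<^sup>1 F\<^sup>T J\<close> for \<open>J = diag(I, - \<theta> I)\<close> and
  \<open>F = [H; L]\<close>. Its right-hand side makes sense for \<open>\<theta> = 0\<close> as well and then agrees with the limit that defines
  \<open>K_inv\<close> there.\<close>

lemma K_inv_vec:
  fixes A :: "real^'n^'n" and B :: "real^'m^'n" and C :: "real^'n^'p" and D :: "real^'n^'q"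
  fixes H :: "real^('k::{finite,linorder} \<times> 'm)^('k \<times> 'p)" and L :: "real^('k \<times> 'm)^('k \<times> 'q)"
  assumes H: "H = toep_mat C A B" and L: "L = toep_mat D A B"
    and inv: "invertible (elim_mat \<theta> H L)"
  defines "m \<equiv> \<lambda>a b. matrix_inv (elim_mat \<theta> H L) *v (transpose H *v a - \<theta> *\<^sub>R (transpose L *v b))"
  shows "K_inv A B C D \<theta> *v stack_vec a b =
    stack_vec (a - H *v m a b) (- \<theta> *\<^sub>R (b - L *v m a b))"
proof -
  let ?M = "elim_mat \<theta> H L"
  define J :: "real^(('k \<times> 'p) + ('k \<times> 'q))^(('k \<times> 'p) + ('k \<times> 'q))"
    where "J = bdiag (mat 1) (- (\<theta> *\<^sub>R mat 1))"
  define X where "X = J - J ** vstack H L ** matrix_inv ?M ** transpose (vstack H L) ** J"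
  have J: "J *v stack_vec a b = stack_vec a (- \<theta> *\<^sub>R b)" for a b
    by (simp add: J_def bdiag_vec minus_matrix_vec scaleR_mat_one_vec)
  have m: "m a b + transpose H *v (H *v m a b) - \<theta> *\<^sub>R (transpose L *v (L *v m a b)) =
      transpose H *v a - \<theta> *\<^sub>R (transpose L *v b)" for a b
    using matrix_inv_cancel(1)[OF inv, of "transpose H *v a - \<theta> *\<^sub>R (transpose L *v b)"]
    by (simp add: m_def elim_mat_def matrix_vector_mult_add_rdistrib indef_gram_vec add_diff_eq)
  have X: "X *v stack_vec a b = stack_vec (a - H *v m a b) (- \<theta> *\<^sub>R (b - L *v m a b))" for a b
  proof -
    have "transpose (vstack H L) *v (J *v stack_vec a b) = transpose H *v a - \<theta> *\<^sub>R (transpose L *v b)"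
      unfolding J vstack_transpose_vec matrix_vector_mult_scaleR by simp
    then have "X *v stack_vec a b = J *v stack_vec a b - J *v (vstack H L *v m a b)"
      by (simp add: X_def matrix_vector_mult_diff_rdistrib matrix_vector_mul_assoc[symmetric] m_def)
    then show ?thesis
      unfolding vstack_vec J stack_vec_diff by (simp add: scaleR_right_diff_distrib)
  qed
  have "K_inv A B C D \<theta> = X"
  proof (cases "\<theta> = 0")
    case False
    let ?K = "K_mat A B C D \<theta> :: real^(('k \<times> 'p) + ('k \<times> 'q))^(('k \<times> 'p) + ('k \<times> 'q))"
    have K: "?K *v stack_vec c d =
        stack_vec (c + H *v (transpose H *v c + transpose L *v d))
          (- (1 / \<theta>) *\<^sub>R d + L *v (transpose H *v c + transpose L *v d))" for c d
      by (simp add: K_mat_def H L Let_def matrix_vector_mult_add_rdistrib bdiag_vec minus_matrix_vec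
          scaleR_mat_one_vec matrix_vector_mul_assoc[symmetric] vstack_transpose_vec vstack_vec
          stack_vec_add)
    have "(?K ** X) *v stack_vec a b = mat 1 *v stack_vec a b" for a b
    proof -
      let ?m = "m a b"
      have h: "transpose H *v (a - H *v ?m) + transpose L *v (- \<theta> *\<^sub>R (b - L *v ?m)) = ?m"
        using m[of a b]
        by (simp add: matrix_vector_mult_diff_distrib matrix_vector_mult_scaleR algebra_simps)
      show ?thesis
        unfolding matrix_vector_mul_assoc[symmetric] X K h using False by simp
    qed
    then have "?K ** X = mat 1" by (rule matrix_eqI_stack)
    then show ?thesis using False by (simp add: K_inv_def matrix_inv_unique)
  next
    case True
    let ?E = "mat 1 + H ** transpose H"
    have "matrix_inv ?E *v a = a - H *v m a b" for a b
    proof -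
      have inj: "x = 0" if "?E *v x = 0" for x
      proof -
        have "x \<bullet> (?E *v x) = x \<bullet> x + (transpose H *v x) \<bullet> (transpose H *v x)"
          by (simp add: matrix_vector_mult_add_rdistrib inner_add_right
              matrix_vector_mul_assoc[symmetric] dot_matrix_vector)
        then have "x \<bullet> x + (transpose H *v x) \<bullet> (transpose H *v x) = 0" by (simp only: that inner_zero_right)
        then have "x \<bullet> x \<le> 0" using inner_ge_zero[of "transpose H *v x"] by linarith
        then show "x = 0" by (metis inner_gt_zero_iff not_less)
      qed
      then have iE: "invertible ?E" unfolding invertible_iff_ker by blast
      have "transpose H *v (a - H *v m a b) = m a b"
        using m[of a b] True by (simp add: matrix_vector_mult_diff_distrib algebra_simps)
      then have "?E *v (a - H *v m a b) = a"
        by (simp add: matrix_vector_mult_add_rdistrib matrix_vector_mul_assoc[symmetric])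
      then show ?thesis using matrix_inv_cancel(2)[OF iE] by metis
    qed
    then have "K_inv A B C D \<theta> *v stack_vec a b = X *v stack_vec a b" for a b
      unfolding X using True by (simp add: K_inv_def Let_def bdiag_vec H)
    then show ?thesis by (rule matrix_eqI_stack)
  qed
  then show ?thesis by (simp only: X)
qed

lemma gain_full_vec:
  fixes A :: "real^'n^'n" and B :: "real^'m^'n" and C :: "real^'n^'p" and D :: "real^'n^'q"
  fixes H :: "real^('k::{finite,linorder} \<times> 'm)^('k \<times> 'p)" and L :: "real^('k \<times> 'm)^('k \<times> 'q)"
  assumes H: "H = toep_mat C A B" and L: "L = toep_mat D A B"
    and inv: "invertible (elim_mat \<theta> H L)"
  shows "gain_full A B C D \<theta> *v stack_vec a b =
    matrix_inv (elim_mat \<theta> H L) *v (transpose H *v a - \<theta> *\<^sub>R (transpose L *v b))"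
proof -
  define m where "m = matrix_inv (elim_mat \<theta> H L) *v (transpose H *v a - \<theta> *\<^sub>R (transpose L *v b))"
  have m: "m + transpose H *v (H *v m) - \<theta> *\<^sub>R (transpose L *v (L *v m)) =
      transpose H *v a - \<theta> *\<^sub>R (transpose L *v b)"
    using matrix_inv_cancel(1)[OF inv, of "transpose H *v a - \<theta> *\<^sub>R (transpose L *v b)"]
    by (simp add: m_def elim_mat_def matrix_vector_mult_add_rdistrib indef_gram_vec add_diff_eq)
  have "gain_full A B C D \<theta> *v stack_vec a b =
      transpose H *v (a - H *v m) + transpose L *v (- \<theta> *\<^sub>R (b - L *v m))"
    by (simp only: gain_full_def matrix_vector_mul_assoc[symmetric] K_inv_vec[OF H L inv]
        m_def H[symmetric] L[symmetric] vstack_transpose_vec)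
  also have "\<dots> = m"
    using m by (simp add: matrix_vector_mult_diff_distrib matrix_vector_mult_scaleR algebra_simps)
  finally show ?thesis by (simp only: m_def)
qed

lemma gain_vec: "gain A B C D \<theta> *v a = gain_full A B C D \<theta> *v stack_vec a 0"
  by (simp add: gain_def vec_eq_iff matrix_vector_mult_def sum_UNIV_plus)

lemma gainR_vec: "gainR A B C D \<theta> *v b = gain_full A B C D \<theta> *v stack_vec 0 b"
  by (simp add: gainR_def vec_eq_iff matrix_vector_mult_def sum_UNIV_plus)

lemma alpha_mat_eq:
  fixes A :: "real^'n^'n" and B :: "real^'m^'n" and C :: "real^'n^'p" and D :: "real^'n^'q"
  fixes H :: "real^('k::{finite,linorder} \<times> 'm)^('k \<times> 'p)" and L :: "real^('k \<times> 'm)^('k \<times> 'q)"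
  assumes H: "H = toep_mat C A B" and L: "L = toep_mat D A B"
    and inv: "invertible (elim_mat \<theta> H L)"
  shows "alpha_mat TYPE('k) A B C D \<theta> = mpow A CARD('k) -
    reach_mat A B ** matrix_inv (elim_mat \<theta> H L) ** indef_gram \<theta> H L (obs_mat C A) (obs_mat D A)"
  unfolding matrix_eq
proof
  fix x
  let ?Ob = "obs_mat C A :: real^'n^('k \<times> 'p)" and ?ObR = "obs_mat D A :: real^'n^('k \<times> 'q)"
  have "gain A B C D \<theta> *v (?Ob *v x) + gainR A B C D \<theta> *v (?ObR *v x) =
      gain_full A B C D \<theta> *v stack_vec (?Ob *v x) (?ObR *v x)"
    by (simp add: gain_vec gainR_vec matrix_vector_right_distrib[symmetric] stack_vec_add)
  also have "\<dots> = matrix_inv (elim_mat \<theta> H L) *v (indef_gram \<theta> H L ?Ob ?ObR *v x)"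
    by (simp add: gain_full_vec[OF H L inv] indef_gram_vec)
  finally show "alpha_mat TYPE('k) A B C D \<theta> *v x = (mpow A CARD('k) -
      reach_mat A B ** matrix_inv (elim_mat \<theta> H L) ** indef_gram \<theta> H L ?Ob ?ObR) *v x"
    by (simp add: alpha_mat_def Let_def matrix_vector_mult_diff_rdistrib
        matrix_vector_mult_add_rdistrib matrix_vector_mul_assoc[symmetric])
qed

lemma Omega_mat_eq:
  fixes A :: "real^'n^'n" and B :: "real^'m^'n" and C :: "real^'n^'p" and D :: "real^'n^'q"
  fixes H :: "real^('k::{finite,linorder} \<times> 'm)^('k \<times> 'p)" and L :: "real^('k \<times> 'm)^('k \<times> 'q)"
  assumes H: "H = toep_mat C A B" and L: "L = toep_mat D A B"
    and inv: "invertible (elim_mat \<theta> H L)"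
  shows "Omega_mat TYPE('k) A B C D \<theta> = schur_mat \<theta> H L (obs_mat C A) (obs_mat D A)"
  unfolding matrix_eq
proof
  fix x
  let ?Ob = "obs_mat C A :: real^'n^('k \<times> 'p)" and ?ObR = "obs_mat D A :: real^'n^('k \<times> 'q)"
  show "Omega_mat TYPE('k) A B C D \<theta> *v x = schur_mat \<theta> H L ?Ob ?ObR *v x"
    by (simp add: Omega_mat_def Let_def matrix_vector_mul_assoc[symmetric] vstack_vec
        K_inv_vec[OF H L inv] vstack_transpose_vec schur_mat_vec indef_gram_vec
        matrix_vector_mult_diff_distrib matrix_vector_mult_scaleR algebra_simps)
qed

lemma W_mat_eq:
  fixes A :: "real^'n^'n" and B :: "real^'m^'n" and C :: "real^'n^'p" and D :: "real^'n^'q"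
  fixes H :: "real^('k::{finite,linorder} \<times> 'm)^('k \<times> 'p)" and L :: "real^('k \<times> 'm)^('k \<times> 'q)"
  assumes H: "H = toep_mat C A B" and L: "L = toep_mat D A B"
  shows "W_mat TYPE('k) A B C D \<theta> =
    reach_mat A B ** matrix_inv (elim_mat \<theta> H L) ** transpose (reach_mat A B)"
  by (simp add: W_mat_def Let_def H L elim_mat_def indef_gram_def add_diff_eq)

lemma elim_mat_pos_def_theta_max:
  fixes A :: "real^'n^'n" and B :: "real^'m^'n" and C :: "real^'n^'p" and D :: "real^'n^'q"
  assumes "0 \<le> \<theta>" "ereal \<theta> < theta_max TYPE('k::{finite,linorder}) A B C D"
  shows "pos_def (elim_mat \<theta> (toep_mat C A B :: real^('k \<times> 'm)^('k \<times> 'p))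
    (toep_mat D A B :: real^('k \<times> 'm)^('k \<times> 'q)))"
  using assms by (intro elim_mat_pos_def) (auto simp: theta_max_def Let_def split: if_splits)

section \<open>Block vectors\<close>

section \<open>Block vectors\<close>

lemma blk_strict_mono: "(i :: 'k::{finite,linorder}) < j \<Longrightarrow> blk i < blk j"
  unfolding blk_def by (intro psubset_card_mono) auto

lemma bij_betw_blk: "bij_betw (blk :: 'k::{finite,linorder} \<Rightarrow> nat) UNIV {..<CARD('k)}"
proof -
  have inj: "inj (blk :: 'k \<Rightarrow> nat)"
    by (intro injI) (metis blk_strict_mono less_irrefl linorder_neqE)
  have "blk i < CARD('k)" for i :: 'k
    unfolding blk_def by (intro psubset_card_mono) auto
  then have "blk ` (UNIV :: 'k set) = {..<CARD('k)}"
    by (intro card_subset_eq) (auto simp: card_image inj)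
  with inj show ?thesis by (simp add: bij_betw_def)
qed

lemma blk_less [simp]: "blk (i :: 'k::{finite,linorder}) < CARD('k)"
  using bij_betw_blk[where 'k = 'k] by (auto simp: bij_betw_def)

lemma blk_surj: "k < CARD('k::{finite,linorder}) \<Longrightarrow> \<exists>i :: 'k. blk i = k"
  using bij_betw_blk[where 'k = 'k] unfolding bij_betw_def by (metis imageE lessThan_iff)

lemma sum_blk: "(\<Sum>i\<in>(UNIV :: 'k::{finite,linorder} set). f (blk i)) = (\<Sum>k<CARD('k). f k)"
  by (rule sum.reindex_bij_betw[OF bij_betw_blk])

lemma sum_UNIV_blk:
  "(\<Sum>y\<in>(UNIV :: ('k::{finite,linorder} \<times> 'b::finite) set). f (blk (fst y)) (snd y))
    = (\<Sum>k<CARD('k). \<Sum>b\<in>UNIV. f k b)"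
proof -
  have "(\<Sum>y\<in>(UNIV :: ('k \<times> 'b) set). f (blk (fst y)) (snd y)) =
      (\<Sum>i\<in>(UNIV :: 'k set). \<Sum>b\<in>UNIV. f (blk i) b)"
    unfolding UNIV_Times_UNIV[symmetric] sum.cartesian_product by (simp add: case_prod_beta)
  then show ?thesis using sum_blk[of "\<lambda>k. \<Sum>b\<in>UNIV. f k b", where 'k = 'k] by simp
qed

text \<open>A sequence of vectors turned into a block vector; only its first \<open>N\<close> terms are seen.\<close>

definition block_vec :: "(nat \<Rightarrow> real^'r) \<Rightarrow> real^('k::{finite,linorder} \<times> 'r::finite)" where
  "block_vec v = (\<chi> x. v (blk (fst x)) $ snd x)"

lemma block_vec_cong: "(\<And>i. i < CARD('k) \<Longrightarrow> v i = w i) \<Longrightarrow> (block_vec v :: real^('k::{finite,linorder} \<times> 'r::finite)) = block_vec w"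
  by (simp add: block_vec_def vec_eq_iff)

lemma block_vec_add: "block_vec v + block_vec w = block_vec (\<lambda>i. v i + w i)"
  by (simp add: block_vec_def vec_eq_iff)

lemma block_vec_diff: "block_vec v - block_vec w = block_vec (\<lambda>i. v i - w i)"
  by (simp add: block_vec_def vec_eq_iff)

lemma block_vec_scaleR: "c *\<^sub>R block_vec v = block_vec (\<lambda>i. c *\<^sub>R v i)"
  by (simp add: block_vec_def vec_eq_iff)

lemma block_vec_eq_0:
  assumes "block_vec v = (0 :: real^('k::{finite,linorder} \<times> 'r::finite))" "k < CARD('k)"
  shows "v k = 0"
proof -
  obtain i :: 'k where i: "blk i = k" using blk_surj[OF assms(2)] by blast
  have "v k $ r = 0" for r
    using arg_cong[OF assms(1), of "\<lambda>z. z $ (i, r)"] by (simp add: block_vec_def i)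
  then show ?thesis by (simp add: vec_eq_iff)
qed

lemma reach_mat_block_vec:
  "reach_mat A B *v (block_vec v :: real^('k::{finite,linorder} \<times> 'm::finite)) = (\<Sum>j<CARD('k). (mpow A j ** B) *v v j)"
  by (simp add: vec_eq_iff reach_mat_def block_vec_def matrix_vector_mult_def[of "vec_lambda _"] matrix_vector_mult_def[of "_ ** _"]
      sum_UNIV_blk[of "\<lambda>j b. (mpow A j ** B) $ _ $ b * v j $ b", where 'k = 'k])

lemma obs_mat_vec:
  "(obs_mat C A *v x :: real^('k::{finite,linorder} \<times> 'r::finite)) = block_vec (\<lambda>i. (C ** mpow A (CARD('k) - 1 - i)) *v x)"
  by (simp add: vec_eq_iff obs_mat_def block_vec_def matrix_vector_mult_def[of "vec_lambda _"] matrix_vector_mult_def[of "_ ** _"])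

lemma toep_mat_block_vec:
  "(toep_mat C A B *v (block_vec v :: real^('k \<times> 'm::finite)) :: real^('k::{finite,linorder} \<times> 'r::finite)) =
    block_vec (\<lambda>i. \<Sum>j<CARD('k). markov C A B (int j - int i) *v v j)"
  by (simp add: vec_eq_iff toep_mat_def block_vec_def matrix_vector_mult_def[of "vec_lambda _"] matrix_vector_mult_def[of "markov _ _ _ _"]
      sum_UNIV_blk[of "\<lambda>j b. markov C A B (int j - _) $ _ $ b * v j $ b", where 'k = 'k])

lemma transpose_reach_mat_vec:
  "(transpose (reach_mat A B) *v p :: real^('k::{finite,linorder} \<times> 'm::finite)) = block_vec (\<lambda>j. transpose (mpow A j ** B) *v p)"
  by (simp add: vec_eq_iff reach_mat_def block_vec_def matrix_vector_mult_def transpose_def)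

lemma transpose_obs_mat_block_vec:
  "transpose (obs_mat C A) *v (block_vec y :: real^('k::{finite,linorder} \<times> 'r::finite)) =
    (\<Sum>i<CARD('k). transpose (C ** mpow A (CARD('k) - 1 - i)) *v y i)"
  by (simp add: vec_eq_iff obs_mat_def block_vec_def matrix_vector_mult_def transpose_def
      sum_UNIV_blk[of "\<lambda>j b. (C ** mpow A (CARD('k) - Suc j)) $ b $ _ * y j $ b", where 'k = 'k])

lemma transpose_toep_mat_block_vec:
  "(transpose (toep_mat C A B) *v (block_vec y :: real^('k \<times> 'r::finite)) :: real^('k::{finite,linorder} \<times> 'm::finite)) =
    block_vec (\<lambda>j. \<Sum>i<CARD('k). transpose (markov C A B (int j - int i)) *v y i)"
  by (simp add: vec_eq_iff toep_mat_def block_vec_def matrix_vector_mult_def transpose_def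
      sum_UNIV_blk[of "\<lambda>i b. markov C A B (_ - int i) $ b $ _ * y i $ b", where 'k = 'k])

section \<open>The two-point boundary value problem\<close>

section \<open>The boundary value problem\<close>

lemma mpow_0 [simp]: "mpow A 0 = mat 1"
  and mpow_Suc: "mpow A (Suc k) = A ** mpow A k"
  by (simp_all add: mpow_def)

lemma mpow_comm: "mpow A k ** A = A ** mpow A k"
  by (induction k) (auto simp: mpow_Suc matrix_mul_assoc[symmetric])

lemma mpow_Suc2: "mpow A (Suc k) = mpow A k ** A"
  by (simp add: mpow_Suc mpow_comm)

text \<open>Index \<open>j\<close> counts time backwards from the end of the block, matching the order of the blocks in
  the reachability and Toeplitz matrices.\<close>

lemma state_expansion:
  fixes A :: "real^'n^'n"
  assumes x: "\<And>j. j < N \<Longrightarrow> \<xi> j = A *v \<xi> (Suc j) + w j"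
  shows "i + d = N \<Longrightarrow> \<xi> i = mpow A d *v \<xi> N + (\<Sum>j=i..<N. mpow A (j - i) *v w j)"
proof (induction d arbitrary: i)
  case 0
  then show ?case by simp
next
  case (Suc d)
  then have i: "i < N" "Suc i + d = N" by auto
  have "\<xi> i = A *v (mpow A d *v \<xi> N + (\<Sum>j=Suc i..<N. mpow A (j - Suc i) *v w j)) + w i"
    using x[OF i(1)] Suc.IH[OF i(2)] by simp
  also have "\<dots> = mpow A (Suc d) *v \<xi> N + ((\<Sum>j=Suc i..<N. mpow A (j - i) *v w j) + w i)"
  proof -
    have "A *v (\<Sum>j=Suc i..<N. mpow A (j - Suc i) *v w j) = (\<Sum>j=Suc i..<N. mpow A (j - i) *v w j)"
      unfolding linear_sum[OF matrix_vector_mul_linear]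
    proof (intro sum.cong refl)
      fix j assume "j \<in> {Suc i..<N}"
      then have "j - i = Suc (j - Suc i)" by auto
      then show "A *v (mpow A (j - Suc i) *v w j) = mpow A (j - i) *v w j"
        by (simp add: mpow_Suc matrix_vector_mul_assoc)
    qed
    then show ?thesis by (simp add: matrix_vector_right_distrib mpow_Suc matrix_vector_mul_assoc)
  qed
  also have "(\<Sum>j=Suc i..<N. mpow A (j - i) *v w j) + w i = (\<Sum>j=i..<N. mpow A (j - i) *v w j)"
    using i(1) by (subst sum.atLeast_Suc_lessThan) auto
  finally show ?case .
qed

lemma costate_expansion:
  fixes A :: "real^'n^'n"
  assumes p: "\<And>j. j < N \<Longrightarrow> \<pi> (Suc j) = transpose A *v \<pi> j - w j"
  shows "j \<le> N \<Longrightarrow> \<pi> j = transpose (mpow A j) *v \<pi> 0 - (\<Sum>i<j. transpose (mpow A (j - 1 - i)) *v w i)"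
proof (induction j)
  case 0
  then show ?case by simp
next
  case (Suc j)
  have "transpose A *v (\<Sum>i<j. transpose (mpow A (j - 1 - i)) *v w i) =
      (\<Sum>i<j. transpose (mpow A (j - i)) *v w i)"
    unfolding linear_sum[OF matrix_vector_mul_linear]
  proof (intro sum.cong refl)
    fix i assume "i \<in> {..<j}"
    then have "j - i = Suc (j - 1 - i)" by auto
    then show "transpose A *v (transpose (mpow A (j - 1 - i)) *v w i) = transpose (mpow A (j - i)) *v w i"
      by (simp add: mpow_Suc2 matrix_vector_mul_assoc matrix_transpose_mul)
  qed
  moreover have "\<pi> (Suc j) = transpose A *v \<pi> j - w j" using p Suc.prems by simp
  ultimately show ?case
    using Suc by (simp add: matrix_vector_mult_diff_distrib mpow_Suc2 matrix_vector_mul_assoc matrix_transpose_mul)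
qed

text \<open>The Markov parameters vanish for \<open>j \<le> i\<close>, so block row \<open>i\<close> of the Toeplitz matrix sees only the
  earlier inputs.\<close>

lemma markov_sum:
  assumes "i < N"
  shows "(\<Sum>j<N. markov C A B (int j - int i) *v v j) =
    C *v (\<Sum>j=Suc i..<N. mpow A (j - Suc i) *v (B *v v j))"
proof -
  have "(\<Sum>j<N. markov C A B (int j - int i) *v v j) = (\<Sum>j=Suc i..<N. markov C A B (int j - int i) *v v j)"
    by (rule sum.mono_neutral_right) (auto simp: markov_def)
  also have "\<dots> = (\<Sum>j=Suc i..<N. C *v (mpow A (j - Suc i) *v (B *v v j)))"
  proof (intro sum.cong refl)
    fix j assume j: "j \<in> {Suc i..<N}"
    then have "nat (int j - int i - 1) = j - Suc i" by auto
    then show "markov C A B (int j - int i) *v v j = C *v (mpow A (j - Suc i) *v (B *v v j))"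
      using j by (simp add: markov_def matrix_vector_mul_assoc matrix_mul_assoc)
  qed
  finally show ?thesis by (simp add: linear_sum[OF matrix_vector_mul_linear])
qed

lemma transpose_markov_sum:
  assumes "j < N"
  shows "(\<Sum>i<N. transpose (markov C A B (int j - int i)) *v y i) =
    transpose B *v (\<Sum>i<j. transpose (mpow A (j - 1 - i)) *v (transpose C *v y i))"
proof -
  have "(\<Sum>i<N. transpose (markov C A B (int j - int i)) *v y i) = (\<Sum>i<j. transpose (markov C A B (int j - int i)) *v y i)"
    using assms by (intro sum.mono_neutral_right) (auto simp: markov_def transpose_def matrix_vector_mult_def vec_eq_iff)
  also have "\<dots> = (\<Sum>i<j. transpose B *v (transpose (mpow A (j - 1 - i)) *v (transpose C *v y i)))"
  proof (intro sum.cong refl)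
    fix i assume i: "i \<in> {..<j}"
    then have "nat (int j - int i - 1) = j - 1 - i" by auto
    then show "transpose (markov C A B (int j - int i)) *v y i =
        transpose B *v (transpose (mpow A (j - 1 - i)) *v (transpose C *v y i))"
      using i by (simp add: markov_def matrix_vector_mul_assoc matrix_transpose_mul matrix_mul_assoc)
  qed
  finally show ?thesis by (simp add: linear_sum[OF matrix_vector_mul_linear])
qed

lemma obs_toep_output:
  fixes A :: "real^'n^'n" and C :: "real^'n^'r"
  assumes x: "\<And>j. j < CARD('k) \<Longrightarrow> \<xi> j = A *v \<xi> (Suc j) + B *v v j"
  shows "obs_mat C A *v \<xi> CARD('k) + toep_mat C A B *v block_vec v =
    (block_vec (\<lambda>i. C *v \<xi> (Suc i)) :: real^('k::{finite,linorder} \<times> 'r::finite))"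
  unfolding obs_mat_vec toep_mat_block_vec block_vec_add
proof (rule block_vec_cong)
  fix i assume i: "i < CARD('k)"
  then have "Suc i + (CARD('k) - 1 - i) = CARD('k)" by simp
  from state_expansion[of "CARD('k)" \<xi> A "\<lambda>j. B *v v j", OF x this]
  show "(C ** mpow A (CARD('k) - 1 - i)) *v \<xi> CARD('k) + (\<Sum>j<CARD('k). markov C A B (int j - int i) *v v j) = C *v \<xi> (Suc i)"
    by (simp add: markov_sum[OF i] matrix_vector_right_distrib matrix_vector_mul_assoc)
qed

text \<open>In block form the recursions say \<open>c = O \<xi>\<^sub>N + H u\<close>, \<open>d = O\<^sup>R \<xi>\<^sub>N + L u\<close> for the outputs and
  \<open>u = R\<^sup>T \<pi>\<^sub>0 - (H\<^sup>T c - \<theta> L\<^sup>T d)\<close> for the inputs. Substituting the former into the latter gives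
  \<open>M u = R\<^sup>T \<pi>\<^sub>0 - G \<xi>\<^sub>N\<close> with \<open>G = H\<^sup>T O - \<theta> L\<^sup>T O\<^sup>R\<close>, and inserting \<open>u\<close> into \<open>\<xi>\<^sub>0\<close> and \<open>\<pi>\<^sub>N\<close> yields the
  coefficients of the block map.\<close>

lemma boundary_value_problem:
  fixes A :: "real^'n^'n" and B :: "real^'m^'n" and C :: "real^'n^'p" and D :: "real^'n^'q"
  fixes H :: "real^('k::{finite,linorder} \<times> 'm::finite)^('k \<times> 'p)" and L :: "real^('k \<times> 'm)^('k \<times> 'q)"
  assumes H: "H = toep_mat C A B" and L: "L = toep_mat D A B"
    and inv: "invertible (elim_mat \<theta> H L)"
    and x: "\<And>j. j < CARD('k) \<Longrightarrow> \<xi> j = A *v \<xi> (Suc j) + B *v (transpose B *v \<pi> j)"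
    and p: "\<And>j. j < CARD('k) \<Longrightarrow> \<pi> (Suc j) = transpose A *v \<pi> j - indef_gram \<theta> C D C D *v \<xi> (Suc j)"
  shows "\<xi> 0 = alpha_mat TYPE('k) A B C D \<theta> *v \<xi> CARD('k) + W_mat TYPE('k) A B C D \<theta> *v \<pi> 0"
    and "\<pi> CARD('k) = transpose (alpha_mat TYPE('k) A B C D \<theta>) *v \<pi> 0
           - Omega_mat TYPE('k) A B C D \<theta> *v \<xi> CARD('k)"
proof -
  let ?N = "CARD('k)" and ?M = "elim_mat \<theta> H L"
  define R where "R = (reach_mat A B :: real^('k \<times> 'm)^'n)"
  define Ob where "Ob = (obs_mat C A :: real^'n^('k \<times> 'p))"
  define ObR where "ObR = (obs_mat D A :: real^'n^('k \<times> 'q))"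
  define G where "G = indef_gram \<theta> H L Ob ObR"
  define u where "u = (block_vec (\<lambda>j. transpose B *v \<pi> j) :: real^('k \<times> 'm))"
  define c where "c = (block_vec (\<lambda>i. C *v \<xi> (Suc i)) :: real^('k \<times> 'p))"
  define d where "d = (block_vec (\<lambda>i. D *v \<xi> (Suc i)) :: real^('k \<times> 'q))"
  have c: "Ob *v \<xi> ?N + H *v u = c" and d: "ObR *v \<xi> ?N + L *v u = d"
    unfolding Ob_def ObR_def H L u_def c_def d_def
    by (rule obs_toep_output, rule x, assumption)+
  have S: "indef_gram \<theta> C D C D *v z = transpose C *v (C *v z) - \<theta> *\<^sub>R (transpose D *v (D *v z))" for z
    by (rule indef_gram_vec)
  have \<pi>: "\<pi> j = transpose (mpow A j) *v \<pi> 0 -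
      ((\<Sum>i<j. transpose (mpow A (j - 1 - i)) *v (transpose C *v (C *v \<xi> (Suc i)))) -
        \<theta> *\<^sub>R (\<Sum>i<j. transpose (mpow A (j - 1 - i)) *v (transpose D *v (D *v \<xi> (Suc i)))))"
    if "j \<le> ?N" for j
    using costate_expansion[of ?N \<pi> A "\<lambda>i. indef_gram \<theta> C D C D *v \<xi> (Suc i)", OF p that]
    by (simp add: S matrix_vector_mult_diff_distrib matrix_vector_mult_scaleR sum_subtractf scaleR_sum_right)
  have u: "u = transpose R *v \<pi> 0 - (transpose H *v c - \<theta> *\<^sub>R (transpose L *v d))"
    unfolding u_def R_def H L c_def d_def transpose_reach_mat_vec transpose_toep_mat_block_vec block_vec_scaleR block_vec_diff
  proof (rule block_vec_cong)
    fix j assume j: "j < ?N"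
    then show "transpose B *v \<pi> j = transpose (mpow A j ** B) *v \<pi> 0 -
        ((\<Sum>i<?N. transpose (markov C A B (int j - int i)) *v (C *v \<xi> (Suc i))) -
         \<theta> *\<^sub>R (\<Sum>i<?N. transpose (markov D A B (int j - int i)) *v (D *v \<xi> (Suc i))))"
      unfolding transpose_markov_sum[OF j] \<pi>[OF less_imp_le[OF j]]
      by (simp add: matrix_vector_mult_diff_distrib matrix_vector_mult_scaleR matrix_transpose_mul matrix_vector_mul_assoc)
  qed
  have \<pi>N: "\<pi> ?N = transpose (mpow A ?N) *v \<pi> 0 - (transpose Ob *v c - \<theta> *\<^sub>R (transpose ObR *v d))"
    unfolding Ob_def ObR_def c_def d_def transpose_obs_mat_block_vec \<pi>[OF order_refl]
    by (simp add: matrix_transpose_mul matrix_vector_mul_assoc matrix_mul_assoc)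
  have \<xi>0: "\<xi> 0 = mpow A ?N *v \<xi> ?N + R *v u"
    using state_expansion[of ?N \<xi> A "\<lambda>j. B *v (transpose B *v \<pi> j)" 0 ?N, OF x]
    by (simp add: R_def u_def reach_mat_block_vec matrix_vector_mul_assoc matrix_mul_assoc atLeast0LessThan)
  have "?M *v u = transpose R *v \<pi> 0 - G *v \<xi> ?N"
    using u unfolding c[symmetric] d[symmetric]
    by (simp add: elim_mat_def G_def indef_gram_vec matrix_vector_mult_add_rdistrib matrix_vector_right_distrib
        scaleR_right_distrib algebra_simps)
  then have u': "u = matrix_inv ?M *v (transpose R *v \<pi> 0 - G *v \<xi> ?N)"
    using matrix_inv_cancel(2)[OF inv, of u] by simp
  have alpha: "alpha_mat TYPE('k) A B C D \<theta> = mpow A ?N - R ** matrix_inv ?M ** G"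
    unfolding R_def G_def Ob_def ObR_def by (rule alpha_mat_eq[OF H L inv])
  have W: "W_mat TYPE('k) A B C D \<theta> = R ** matrix_inv ?M ** transpose R"
    unfolding R_def by (rule W_mat_eq[OF H L])
  have Om: "Omega_mat TYPE('k) A B C D \<theta> = indef_gram \<theta> Ob ObR Ob ObR - transpose G ** matrix_inv ?M ** G"
    unfolding Omega_mat_eq[OF H L inv] schur_mat_def G_def Ob_def ObR_def indef_gram_transpose ..
  show "\<xi> 0 = alpha_mat TYPE('k) A B C D \<theta> *v \<xi> ?N + W_mat TYPE('k) A B C D \<theta> *v \<pi> 0"
    unfolding \<xi>0 u' alpha W
    by (simp add: matrix_vector_mult_diff_distrib matrix_vector_mult_diff_rdistrib matrix_vector_mul_assoc matrix_mul_assoc)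
  have tr: "transpose (alpha_mat TYPE('k) A B C D \<theta>) = transpose (mpow A ?N) - transpose G ** matrix_inv ?M ** transpose R"
    by (simp add: alpha transpose_diff matrix_transpose_mul transpose_matrix_inv[OF inv elim_mat_sym] matrix_mul_assoc)
  have "transpose Ob *v c - \<theta> *\<^sub>R (transpose ObR *v d) = indef_gram \<theta> Ob ObR Ob ObR *v \<xi> ?N + transpose G *v u"
    unfolding c[symmetric] d[symmetric] G_def indef_gram_transpose
    by (simp add: indef_gram_vec matrix_vector_right_distrib scaleR_right_distrib algebra_simps)
  then show "\<pi> ?N = transpose (alpha_mat TYPE('k) A B C D \<theta>) *v \<pi> 0 - Omega_mat TYPE('k) A B C D \<theta> *v \<xi> ?N"
    unfolding \<pi>N tr Om u'
    by (simp add: matrix_vector_mult_diff_distrib matrix_vector_mult_diff_rdistrib matrix_vector_mul_assoc matrix_mul_assoc)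
qed

section \<open>The block Riccati map\<close>

lemma orthogonal_to_full_dim:
  fixes x :: "real^'n"
  assumes "dim S = CARD('n)" and orth: "\<And>y. y \<in> S \<Longrightarrow> x \<bullet> y = 0"
  shows "x = 0"
proof -
  have "span S = UNIV" using assms(1) dim_eq_full[of S] by simp
  then have "orthogonal x x"
    using orthogonal_to_span[of x S x] orth by (simp add: orthogonal_def)
  then show ?thesis by (simp add: orthogonal_def)
qed

lemma reach_mat_transpose_inj:
  fixes A :: "real^'n^'n" and B :: "real^'m^'n"
  assumes reach: "reachable A B" and N: "CARD('k::{finite,linorder}) \<ge> CARD('n)"
    and x: "transpose (reach_mat A B :: real^('k \<times> 'm)^'n) *v x = 0"
  shows "x = 0"
proof (rule orthogonal_to_full_dim)
  show "dim (\<Union>k<CARD('n). columns (mpow A k ** B)) = CARD('n)"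
    using reach by (simp only: reachable_def)
  fix y assume "y \<in> (\<Union>k<CARD('n). columns (mpow A k ** B))"
  then obtain k i where k: "k < CARD('n)" and y: "y = column i (mpow A k ** B)"
    by (auto simp: columns_def)
  have "(block_vec (\<lambda>j. transpose (mpow A j ** B) *v x) :: real^('k \<times> 'm)) = 0"
    using x by (simp only: transpose_reach_mat_vec)
  from block_vec_eq_0[OF this, of k] have "transpose (mpow A k ** B) *v x = 0"
    using k N by simp
  then have "(transpose (mpow A k ** B) *v x) $ i = 0" by simp
  then show "x \<bullet> y = 0"
    by (simp add: y matrix_vector_mul_component inner_commute column_def transpose_def inner_vec_def mult.commute)
qed

lemma obs_mat_inj:
  fixes A :: "real^'n^'n" and C :: "real^'n^'p"
  assumes obs: "observable C A" and N: "CARD('k::{finite,linorder}) \<ge> CARD('n)"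
    and x: "(obs_mat C A :: real^'n^('k \<times> 'p)) *v x = 0"
  shows "x = 0"
proof (rule orthogonal_to_full_dim)
  show "dim (\<Union>k<CARD('n). rows (C ** mpow A k)) = CARD('n)"
    using obs by (simp only: observable_def)
  fix y assume "y \<in> (\<Union>k<CARD('n). rows (C ** mpow A k))"
  then obtain k i where k: "k < CARD('n)" and y: "y = row i (C ** mpow A k)"
    by (auto simp: rows_def)
  have "(block_vec (\<lambda>i. (C ** mpow A (CARD('k) - 1 - i)) *v x) :: real^('k \<times> 'p)) = 0"
    using x by (simp only: obs_mat_vec)
  from block_vec_eq_0[OF this, of "CARD('k) - 1 - k"] have "(C ** mpow A k) *v x = 0"
    using k N by simp
  then have "((C ** mpow A k) *v x) $ i = 0" by simp
  then show "x \<bullet> y = 0"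
    by (simp add: y matrix_vector_mul_component inner_commute row_def)
qed

lemma W_mat_pos_def:
  fixes A :: "real^'n^'n" and B :: "real^'m^'n" and C :: "real^'n^'p" and D :: "real^'n^'q"
  assumes reach: "reachable A B" and N: "CARD('k::{finite,linorder}) \<ge> CARD('n)"
    and M: "pos_def (elim_mat \<theta> (toep_mat C A B :: real^('k \<times> 'm)^('k \<times> 'p))
      (toep_mat D A B :: real^('k \<times> 'm)^('k \<times> 'q)))"
  shows "pos_def (W_mat TYPE('k) A B C D \<theta>)"
  unfolding pos_def_def W_mat_eq[OF refl refl]
proof (intro conjI allI impI)
  let ?R = "reach_mat A B :: real^('k \<times> 'm)^'n"
  let ?I = "matrix_inv (elim_mat \<theta> (toep_mat C A B :: real^('k \<times> 'm)^('k \<times> 'p))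
      (toep_mat D A B :: real^('k \<times> 'm)^('k \<times> 'q)))"
  note I = pos_def_matrix_inv[OF M]
  show "transpose (?R ** ?I ** transpose ?R) = ?R ** ?I ** transpose ?R"
    using I by (simp add: pos_def_def matrix_transpose_mul matrix_mul_assoc)
  fix x :: "real^'n" assume "x \<noteq> 0"
  then have "transpose ?R *v x \<noteq> 0" using reach_mat_transpose_inj[OF reach N] by blast
  then have "0 < (transpose ?R *v x) \<bullet> (?I *v (transpose ?R *v x))" using I by (simp add: pos_def_def)
  then show "0 < x \<bullet> (?R ** ?I ** transpose ?R *v x)"
    by (simp add: matrix_vector_mul_assoc[symmetric] dot_matrix_vector[of x ?R])
qed

lemma riccati_block_mobius:
  "riccati_block TYPE('k::{finite,linorder}) A B C D \<theta> =
    mobius (alpha_mat TYPE('k) A B C D \<theta>) (Omega_mat TYPE('k) A B C D \<theta>) (W_mat TYPE('k) A B C D \<theta>)"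
  by (simp add: fun_eq_iff riccati_block_def mobius_def par_sum_def)

text \<open>For a given \<open>p = \<pi>\<^sub>0\<close> a solution of the boundary value problem is built from the iterates \<open>Q\<^sub>j\<close>
  (numbered backwards, so \<open>Q\<^sub>N = P\<close>) with \<open>\<xi>\<^sub>j = Q\<^sub>j \<pi>\<^sub>j\<close> at every step. Both \<open>\<xi>\<^sub>0 = Q\<^sub>0 p\<close> and, after eliminating
  \<open>\<xi>\<^sub>N\<close>, \<open>\<xi>\<^sub>0 = f(P) p\<close>. Intermediate iterates may be indefinite.\<close>

lemma riccati_iterate:
  fixes A :: "real^'n^'n" and B :: "real^'m^'n" and C :: "real^'n^'p" and D :: "real^'n^'q"
  fixes H :: "real^('k::{finite,linorder} \<times> 'm)^('k \<times> 'p)" and L :: "real^('k \<times> 'm)^('k \<times> 'q)"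
  assumes H: "H = toep_mat C A B" and L: "L = toep_mat D A B"
    and inv: "invertible (elim_mat \<theta> H L)"
    and P: "pos_def P" and \<Omega>: "pos_def (Omega_mat TYPE('k) A B C D \<theta>)"
    and dfd: "riccati_iter_defined CARD('k) A B C D \<theta> P"
  shows "riccati_block TYPE('k) A B C D \<theta> P = (riccati A B C D \<theta> ^^ CARD('k)) P"
  unfolding matrix_eq
proof
  fix p
  let ?N = "CARD('k)" and ?S = "indef_gram \<theta> C D C D"
  let ?\<alpha> = "alpha_mat TYPE('k) A B C D \<theta>" and ?\<Omega> = "Omega_mat TYPE('k) A B C D \<theta>"
    and ?W = "W_mat TYPE('k) A B C D \<theta>"
  define Q where "Q j = (riccati A B C D \<theta> ^^ (?N - j)) P" for j
  define \<pi> where "\<pi> = rec_nat p (\<lambda>j \<pi>. matrix_inv (Q (Suc j)) *v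
      (matrix_inv (matrix_inv (Q (Suc j)) + ?S) *v (transpose A *v \<pi>)))"
  have \<pi>0: "\<pi> 0 = p" and \<pi>Suc: "\<pi> (Suc j) = matrix_inv (Q (Suc j)) *v
      (matrix_inv (matrix_inv (Q (Suc j)) + ?S) *v (transpose A *v \<pi> j))" for j
    by (simp_all add: \<pi>_def)
  define \<xi> where "\<xi> j = Q j *v \<pi> j" for j
  have S: "matrix_inv X + transpose C ** C - \<theta> *\<^sub>R (transpose D ** D) = matrix_inv X + ?S" for X
    by (simp add: indef_gram_def)
  have inv1: "invertible (Q (Suc j))" and inv2: "invertible (matrix_inv (Q (Suc j)) + ?S)"
    if "j < ?N" for j
    using dfd that unfolding riccati_iter_defined_def riccati_defined_def S Q_def by auto
  have Q: "Q j = A ** matrix_inv (matrix_inv (Q (Suc j)) + ?S) ** transpose A + B ** transpose B"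
    if "j < ?N" for j
  proof -
    have "?N - j = Suc (?N - Suc j)" using that by simp
    then have "Q j = riccati A B C D \<theta> (Q (Suc j))" by (simp add: Q_def)
    then show ?thesis by (simp only: riccati_def S)
  qed
  have \<xi>Suc: "\<xi> (Suc j) = matrix_inv (matrix_inv (Q (Suc j)) + ?S) *v (transpose A *v \<pi> j)" if "j < ?N" for j
    by (simp add: \<xi>_def \<pi>Suc matrix_inv_cancel(1)[OF inv1[OF that]])
  have x: "\<xi> j = A *v \<xi> (Suc j) + B *v (transpose B *v \<pi> j)" if "j < ?N" for j
    unfolding \<xi>Suc[OF that] unfolding \<xi>_def Q[OF that]
    by (simp add: matrix_vector_mult_add_rdistrib matrix_vector_mul_assoc matrix_mul_assoc)
  have p: "\<pi> (Suc j) = transpose A *v \<pi> j - ?S *v \<xi> (Suc j)" if "j < ?N" for j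
  proof -
    have "(matrix_inv (Q (Suc j)) + ?S) *v \<xi> (Suc j) = transpose A *v \<pi> j"
      unfolding \<xi>Suc[OF that] by (rule matrix_inv_cancel(1)[OF inv2[OF that]])
    moreover have "matrix_inv (Q (Suc j)) *v \<xi> (Suc j) = \<pi> (Suc j)"
      by (simp add: \<xi>_def matrix_inv_cancel(2)[OF inv1[OF that]])
    ultimately show ?thesis by (simp add: matrix_vector_mult_add_rdistrib algebra_simps)
  qed
  note bvp = boundary_value_problem[OF H L inv, of \<xi> \<pi>, OF x p]
  let ?x = "\<xi> ?N"
  have "Q ?N = P" by (simp add: Q_def)
  then have "matrix_inv P *v ?x = \<pi> ?N"
    by (simp add: \<xi>_def matrix_inv_cancel(2)[OF pos_def_invertible[OF P]])
  then have "(matrix_inv P + ?\<Omega>) *v ?x = transpose ?\<alpha> *v p"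
    using bvp(2) by (simp add: matrix_vector_mult_add_rdistrib \<pi>0)
  then have "?x = par_sum ?\<Omega> P *v (transpose ?\<alpha> *v p)"
    unfolding par_sum_def
    using matrix_inv_cancel(2)[OF pos_def_invertible[OF pos_def_add[OF pos_def_matrix_inv[OF P] \<Omega>]], of ?x]
    by simp
  then have "\<xi> 0 = mobius ?\<alpha> ?\<Omega> ?W P *v p"
    using bvp(1) by (simp add: mobius_def \<pi>0 matrix_vector_mult_add_rdistrib matrix_vector_mul_assoc matrix_mul_assoc)
  moreover have "\<xi> 0 = (riccati A B C D \<theta> ^^ ?N) P *v p"
    by (simp add: \<xi>_def \<pi>0 Q_def)
  ultimately show "riccati_block TYPE('k) A B C D \<theta> P *v p = (riccati A B C D \<theta> ^^ ?N) P *v p"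
    by (simp add: riccati_block_mobius)
qed

theorem mainTheorem2:
  fixes A :: "real^'n^'n" and B :: "real^'m^'n" and C :: "real^'n^'p" and D :: "real^'n^'q"
    and \<tau> :: real
  assumes "CARD('q) \<le> CARD('n)" and "rank D = CARD('q)"
    and "reachable A B" and "observable C A"
    and "CARD('k::{finite,linorder}) \<ge> CARD('n)"
    and "0 \<le> \<tau>" and "ereal \<tau> < theta_max TYPE('k) A B C D"
    and "\<not> invertible (Omega_mat TYPE('k) A B C D \<tau>)"
    and "\<And>\<eta>. 0 \<le> \<eta> \<Longrightarrow> \<eta> < \<tau> \<Longrightarrow> invertible (Omega_mat TYPE('k) A B C D \<eta>)"
  shows "\<forall>\<theta>. 0 \<le> \<theta> \<and> \<theta> < \<tau> \<longrightarrow>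
           pos_def (Omega_mat TYPE('k) A B C D \<theta>) \<and>
           pos_def (W_mat TYPE('k) A B C D \<theta>) \<and>
           strictly_contractive (riccati_block TYPE('k) A B C D \<theta>) \<and>
           (\<exists>!P. pos_def P \<and> riccati_block TYPE('k) A B C D \<theta> P = P) \<and>
           (\<forall>P. pos_def P \<longrightarrow> riccati_iter_defined CARD('k) A B C D \<theta> P \<longrightarrow>
                riccati_block TYPE('k) A B C D \<theta> P = (riccati A B C D \<theta> ^^ CARD('k)) P)"
proof (intro allI impI)
  fix \<theta> assume \<theta>: "0 \<le> \<theta> \<and> \<theta> < \<tau>"
  define H where "H = (toep_mat C A B :: real^('k \<times> 'm)^('k \<times> 'p))"
  define L where "L = (toep_mat D A B :: real^('k \<times> 'm)^('k \<times> 'q))"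
  let ?Om = "Omega_mat TYPE('k) A B C D" and ?W = "W_mat TYPE('k) A B C D"
  have M: "pos_def (elim_mat \<eta> H L)" if "0 \<le> \<eta>" "\<eta> \<le> \<theta>" for \<eta>
  proof -
    have "ereal \<eta> \<le> ereal \<tau>" using that \<theta> by simp
    then have "ereal \<eta> < theta_max TYPE('k) A B C D" using assms(7) by (rule le_less_trans)
    then show ?thesis unfolding H_def L_def by (rule elim_mat_pos_def_theta_max[OF that(1)])
  qed
  note M\<theta> = M[of \<theta>, OF conjunct1[OF \<theta>] order_refl]
  have Om: "?Om \<eta> = schur_mat \<eta> H L (obs_mat C A) (obs_mat D A)" if "0 \<le> \<eta>" "\<eta> \<le> \<theta>" for \<eta>
    by (rule Omega_mat_eq[OF H_def L_def pos_def_invertible[OF M[OF that]]])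
  have \<Omega>: "pos_def (?Om \<theta>)"
    unfolding Om[OF conjunct1[OF \<theta>] order_refl]
  proof (rule schur_mat_pos_def_before_singular)
    show "invertible (schur_mat \<eta> H L (obs_mat C A) (obs_mat D A))" if "0 \<le> \<eta>" "\<eta> \<le> \<theta>" for \<eta>
      using assms(9)[of \<eta>] that \<theta> Om[OF that] by simp
  qed (use M \<theta> obs_mat_inj[OF assms(4,5)] in auto)
  have W: "pos_def (?W \<theta>)"
    by (rule W_mat_pos_def[OF assms(3,5)]) (use M\<theta> in \<open>simp only: H_def L_def\<close>)
  show "pos_def (?Om \<theta>) \<and> pos_def (?W \<theta>) \<and>
      strictly_contractive (riccati_block TYPE('k) A B C D \<theta>) \<and>
      (\<exists>!P. pos_def P \<and> riccati_block TYPE('k) A B C D \<theta> P = P) \<and>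
      (\<forall>P. pos_def P \<longrightarrow> riccati_iter_defined CARD('k) A B C D \<theta> P \<longrightarrow>
           riccati_block TYPE('k) A B C D \<theta> P = (riccati A B C D \<theta> ^^ CARD('k)) P)"
  proof (intro conjI allI impI)
    show "strictly_contractive (riccati_block TYPE('k) A B C D \<theta>)"
      unfolding riccati_block_mobius by (rule mobius_strictly_contractive[OF \<Omega> W])
    show "\<exists>!P. pos_def P \<and> riccati_block TYPE('k) A B C D \<theta> P = P"
      unfolding riccati_block_mobius by (rule mobius_unique_fixed_point[OF \<Omega> W])
    show "riccati_block TYPE('k) A B C D \<theta> P = (riccati A B C D \<theta> ^^ CARD('k)) P"
      if "pos_def P" "riccati_iter_defined CARD('k) A B C D \<theta> P" for P
      by (rule riccati_iterate[OF H_def L_def pos_def_invertible[OF M\<theta>] that(1) \<Omega> that(2)])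
  qed (rule \<Omega> W)+
qed

end
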